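(* Let $\alpha : [0,+\infty) \to [1,+\infty)$ be a continuous and nondecreasing function. Let $X := \mathcal{C}([0,+\infty)) \cap L^1([0,+\infty))$, endowed with the metric $$d_X(f,g) := \|f-g\|_{L^1} + \sum_{n=1}^{\infty} \frac{1}{2^n}\cdot \frac{\|f-g\|_{\infty,n}}{1+\|f-g\|_{\infty,n}},\qquad \|f\|_{\infty,n} = \max\{|f(x)| : x\in[0,n]\},$$ and let $$\mathcal{A}(\alpha) = \left\{ f\in X : \limsup_{x\to+\infty}\frac{|f(x)|}{\alpha(x)}=+\infty\right\}$$ be the family of continuous and integrable functions on $[0,+\infty)$ with growth $\alpha$. Then $\mathcal{A}(\alpha)$ is maximal dense-lineable in $X$ and strongly algebrable; that is: (i) there is a vector subspace $M\subset X$, dense in $(X,d_X)$, with $\dim(M)=\dim(X)$ and $M\setminus\{0\}\subset\mathcal{A}(\alpha)$; and (ii) there is an infinitely generated free (commutative) subalgebra $N$ of the algebra $\mathcal{C}([0,+\infty))$ with pointwise operations such that $N\setminus\{0\}\subset\mathcal{A}(\alpha)$.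
   Context: $\mathcal{C}([0,+\infty))$ is the real algebra of all continuous functions $[0,+\infty)\to\mathbb{R}$ with pointwise operations, and $L^1([0,+\infty))$ is the space of Lebesgue integrable functions on $[0,+\infty)$ with $\|f\|_{L^1}=\int_0^\infty |f(x)|\,dx$. A function $f\in\mathcal{C}([0,+\infty))$ has growth $\alpha$ if $\limsup_{x\to+\infty}|f(x)|/\alpha(x)=+\infty$. Dimension means algebraic (Hamel) dimension over $\mathbb{R}$. A subset $A$ of a topological vector space $X$ is maximal dense-lineable if there is a dense vector subspace $M$ of $X$ with $M\setminus\{0\}\subset A$ and $\dim(M)=\dim(X)$. Subalgebras are not required to contain a unit. A subset $A$ of a commutative algebra is strongly algebrable if there is a free algebra $N$ with $N\setminus\{0\}\subset A$ that is infinitely generated (every system of generators is infinite). Equivalently, there is an infinite set $B$ generating the algebra $N$ such that for every $s\in\mathbb{N}$, every nonzero polynomial $P$ in $s$ variables without constant term and all distinct $f_1,\dots,f_s\in B$, one has $P(f_1,\dots,f_s)\in N\setminus\{0\}$, and $N\setminus\{0\}\subset A$. *)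

theory Defs
  imports
    "HOL-Analysis.Analysis"
    "HOL-Library.Function_Algebras"
    "HOL-Library.Poly_Mapping"
    "HOL-Library.Equipollence"
begin

section \<open>Real-valued functions as a real algebra with pointwise operations\<close>

instantiation "fun" :: (type, real_vector) real_vector
begin

definition scaleR_fun :: "real \<Rightarrow> ('a \<Rightarrow> 'b) \<Rightarrow> 'a \<Rightarrow> 'b"
  where "scaleR_fun c f = (\<lambda>x. c *\<^sub>R f x)"

instance
  by standard (simp_all add: scaleR_fun_def fun_eq_iff scaleR_add_right scaleR_add_left)

end

lemma scaleR_fun_apply [simp]: "(c *\<^sub>R f) x = c *\<^sub>R f x"
  by (simp add: scaleR_fun_def)

instance "fun" :: (type, real_algebra) real_algebra
  by standard (simp_all add: fun_eq_iff)

instance "fun" :: (type, real_algebra_1) real_algebra_1 ..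


section \<open>Maximal dense-lineability\<close>

text \<open>Equality of Hamel dimensions as cardinal numbers. (The library's \<open>dim\<close> is a natural number
  and is 0 for every infinite-dimensional space.)\<close>

definition same_hamel_dim :: "'a::real_vector set \<Rightarrow> 'a set \<Rightarrow> bool" where
  "same_hamel_dim V W \<longleftrightarrow>
     (\<exists>B C. independent B \<and> span B = V \<and> independent C \<and> span C = W \<and> B \<approx> C)"

text \<open>The ambient vector space is the carrier of the topology \<open>T\<close>.\<close>

definition maximal_dense_lineable :: "'a::real_vector topology \<Rightarrow> 'a set \<Rightarrow> bool" where
  "maximal_dense_lineable T A \<longleftrightarrow>
     (\<exists>M. subspace M \<and> M \<subseteq> topspace T \<and> T closure_of M = topspace T
        \<and> same_hamel_dim M (topspace T) \<and> M - {0} \<subseteq> A)"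


section \<open>Strong algebrability\<close>

text \<open>Subalgebras need not contain a unit; \<open>subalgebra hull B\<close> is the subalgebra generated by \<open>B\<close>.\<close>

definition subalgebra :: "'a::real_algebra set \<Rightarrow> bool" where
  "subalgebra S \<longleftrightarrow> subspace S \<and> (\<forall>x\<in>S. \<forall>y\<in>S. x * y \<in> S)"

text \<open>A real polynomial in the variables \<open>0, 1, 2, \<dots>\<close> maps each monomial, i.e. each finitely
  supported exponent vector, to its coefficient.\<close>

type_synonym real_mpoly = "(nat \<Rightarrow>\<^sub>0 nat) \<Rightarrow>\<^sub>0 real"

definition poly_in :: "nat \<Rightarrow> real_mpoly \<Rightarrow> bool" where
  "poly_in s P \<longleftrightarrow> (\<forall>m\<in>Poly_Mapping.keys P. Poly_Mapping.keys m \<subseteq> {..<s})"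

abbreviation const_term :: "real_mpoly \<Rightarrow> real" where
  "const_term P \<equiv> Poly_Mapping.lookup P 0"

text \<open>The unit of \<open>'a\<close> only occurs in the value of the monomial 0, hence not for polynomials
  without constant term.\<close>

definition eval_poly :: "real_mpoly \<Rightarrow> (nat \<Rightarrow> 'a) \<Rightarrow> 'a::{real_algebra_1,comm_ring_1}" where
  "eval_poly P f =
     (\<Sum>m\<in>Poly_Mapping.keys P. Poly_Mapping.lookup P m *\<^sub>R
        (\<Prod>i\<in>Poly_Mapping.keys m. f i ^ Poly_Mapping.lookup m i))"

definition free_generators :: "'a::{real_algebra_1,comm_ring_1} set \<Rightarrow> 'a set \<Rightarrow> bool" where
  "free_generators N B \<longleftrightarrow> subalgebra hull B = N \<and>
     (\<forall>s P f. poly_in s P \<and> P \<noteq> 0 \<and> const_term P = 0 \<and> inj_on f {..<s} \<and> f ` {..<s} \<subseteq> B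
        \<longrightarrow> eval_poly P f \<in> N - {0})"

definition free_algebra :: "'a::{real_algebra_1,comm_ring_1} set \<Rightarrow> bool" where
  "free_algebra N \<longleftrightarrow> (\<exists>B. free_generators N B)"

definition infinitely_generated :: "'a::real_algebra set \<Rightarrow> bool" where
  "infinitely_generated N \<longleftrightarrow> (\<forall>S. subalgebra hull S = N \<longrightarrow> infinite S)"

text \<open>\<open>E\<close> is the ambient commutative algebra.\<close>

definition strongly_algebrable :: "'a::{real_algebra_1,comm_ring_1} set \<Rightarrow> 'a set \<Rightarrow> bool" where
  "strongly_algebrable E A \<longleftrightarrow>
     (\<exists>N. subalgebra N \<and> N \<subseteq> E \<and> free_algebra N \<and> infinitely_generated N \<and> N - {0} \<subseteq> A)"


section \<open>Continuous and integrable functions on the half-line\<close>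

text \<open>A function on \<open>[0,\<infinity>)\<close> is represented by its extension by 0 to the whole real line, so that
  distinct elements of the following set are distinct functions on \<open>[0,\<infinity>)\<close> and the operations of
  the type \<open>real \<Rightarrow> real\<close> are the pointwise ones on \<open>[0,\<infinity>)\<close>. No continuity from the left is
  required at 0.\<close>

definition cont_half :: "(real \<Rightarrow> real) set" where
  "cont_half = {f. continuous_on {0..} f \<and> (\<forall>x<0. f x = 0)}"

definition cont_L1 :: "(real \<Rightarrow> real) set" where
  "cont_L1 = {f \<in> cont_half. f absolutely_integrable_on {0..}}"

definition L1_norm :: "(real \<Rightarrow> real) \<Rightarrow> real" where
  "L1_norm f = (LINT x:{0..}|lebesgue. \<bar>f x\<bar>)"

text \<open>For continuous \<open>f\<close> the supremum is a maximum.\<close>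

definition sup_norm :: "nat \<Rightarrow> (real \<Rightarrow> real) \<Rightarrow> real" where
  "sup_norm n f = (SUP x\<in>{0..real n}. \<bar>f x\<bar>)"

text \<open>Locale \<open>Metric_space\<close> requires symmetry and nonnegativity also outside the
  carrier, hence the dummy value there.\<close>

definition dist_X :: "(real \<Rightarrow> real) \<Rightarrow> (real \<Rightarrow> real) \<Rightarrow> real" where
  "dist_X f g =
     (if f \<in> cont_L1 \<and> g \<in> cont_L1
      then L1_norm (f - g)
         + suminf (\<lambda>k. let n = Suc k in 1 / 2 ^ n * (sup_norm n (f - g) / (1 + sup_norm n (f - g))))
      else 0)"

definition topology_X :: "(real \<Rightarrow> real) topology" where
  "topology_X = Metric_space.mtopology cont_L1 dist_X"

definition growth_set :: "(real \<Rightarrow> real) \<Rightarrow> (real \<Rightarrow> real) set" where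
  "growth_set \<alpha> = {f \<in> cont_L1. Limsup at_top (\<lambda>x. ereal (\<bar>f x\<bar> / \<alpha> x)) = \<infinity>}"


subsection \<open>\<open>dist_X\<close> is a metric\<close>

lemma subspace_cont_half: "subspace cont_half"
  unfolding subspace_def cont_half_def
  by (auto simp: plus_fun_def scaleR_fun_def zero_fun_def intro!: continuous_intros)

lemma subspace_cont_L1: "subspace cont_L1"
  using subspace_cont_half unfolding subspace_def cont_L1_def
  by (auto simp: plus_fun_def scaleR_fun_def zero_fun_def
      intro!: set_integral_add absolutely_integrable_scaleR_left set_integrable_mult_right)

lemma subalgebra_cont_half: "subalgebra cont_half"
  using subspace_cont_half unfolding subalgebra_def
  by (auto simp: cont_half_def times_fun_def intro!: continuous_intros)

lemma sup_norm_bdd: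
  assumes "f \<in> cont_half"
  shows "bdd_above ((\<lambda>x. \<bar>f x\<bar>) ` {0..real n})"
proof -
  have "continuous_on {0..real n} (\<lambda>x. \<bar>f x\<bar>)"
    using assms unfolding cont_half_def
    by (auto intro!: continuous_intros intro: continuous_on_subset)
  then have "compact ((\<lambda>x. \<bar>f x\<bar>) ` {0..real n})"
    by (intro compact_continuous_image) auto
  then show ?thesis
    by (intro bounded_imp_bdd_above compact_imp_bounded)
qed

lemma abs_le_sup_norm:
  assumes "f \<in> cont_half" "0 \<le> x" "x \<le> real n"
  shows "\<bar>f x\<bar> \<le> sup_norm n f"
  unfolding sup_norm_def using assms by (intro cSUP_upper sup_norm_bdd) auto

lemma sup_norm_nonneg: "f \<in> cont_half \<Longrightarrow> 0 \<le> sup_norm n f"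
  using abs_le_sup_norm[of f 0 n] by fastforce

lemma sup_norm_add:
  assumes "f \<in> cont_half" "g \<in> cont_half"
  shows "sup_norm n (f + g) \<le> sup_norm n f + sup_norm n g"
  unfolding sup_norm_def[of n "f + g"]
proof (rule cSUP_least)
  fix x assume "x \<in> {0..real n}"
  then show "\<bar>(f + g) x\<bar> \<le> sup_norm n f + sup_norm n g"
    using abs_le_sup_norm[OF assms(1), of x n] abs_le_sup_norm[OF assms(2), of x n] by auto
qed simp

lemma frac_mono_subadd:
  fixes a b c :: real
  assumes "0 \<le> a" "0 \<le> b" "0 \<le> c" "c \<le> a + b"
  shows "c / (1 + c) \<le> a / (1 + a) + b / (1 + b)"
proof -
  have "c / (1 + c) \<le> (a + b) / (1 + (a + b))"
    using assms by (simp add: divide_simps) (simp add: algebra_simps)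
  also have "\<dots> = a / (1 + (a + b)) + b / (1 + (a + b))"
    by (simp add: add_divide_distrib)
  also have "\<dots> \<le> a / (1 + a) + b / (1 + b)"
    using assms by (intro add_mono divide_left_mono) auto
  finally show ?thesis .
qed

definition dist_term :: "(real \<Rightarrow> real) \<Rightarrow> nat \<Rightarrow> real" where
  "dist_term h k = 1 / 2 ^ Suc k * (sup_norm (Suc k) h / (1 + sup_norm (Suc k) h))"

lemma dist_term_nonneg: "h \<in> cont_half \<Longrightarrow> 0 \<le> dist_term h k"
  unfolding dist_term_def by (simp add: sup_norm_nonneg)

lemma summable_dist_term:
  assumes "h \<in> cont_half"
  shows "summable (dist_term h)"
proof (rule summable_comparison_test')
  show "summable (\<lambda>k. (1 / 2) ^ Suc k :: real)"
    by (intro summable_Suc_iff[THEN iffD2] summable_geometric) simp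
  fix k :: nat
  have "sup_norm (Suc k) h / (1 + sup_norm (Suc k) h) \<le> 1"
    using sup_norm_nonneg[OF assms, of "Suc k"] by simp
  then have "dist_term h k \<le> 1 / 2 ^ Suc k * 1"
    unfolding dist_term_def by (intro mult_left_mono) auto
  then show "norm (dist_term h k) \<le> (1 / 2) ^ Suc k"
    using dist_term_nonneg[OF assms, of k] by (simp add: power_one_over)
qed

lemma dist_X_eq:
  assumes "f \<in> cont_L1" "g \<in> cont_L1"
  shows "dist_X f g = L1_norm (f - g) + suminf (dist_term (f - g))"
  using assms unfolding dist_X_def dist_term_def[abs_def] Let_def by simp

lemma L1_norm_nonneg: "0 \<le> L1_norm f"
  unfolding L1_norm_def set_lebesgue_integral_def
  by (intro integral_nonneg_AE) auto

lemma L1_norm_add: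
  assumes "f \<in> cont_L1" "g \<in> cont_L1"
  shows "L1_norm (f + g) \<le> L1_norm f + L1_norm g"
proof -
  have f: "set_integrable lebesgue {0..} (\<lambda>x. \<bar>f x\<bar>)"
    and g: "set_integrable lebesgue {0..} (\<lambda>x. \<bar>g x\<bar>)"
    and fg: "set_integrable lebesgue {0..} (\<lambda>x. \<bar>(f + g) x\<bar>)"
    using assms subspace_add[OF subspace_cont_L1 assms]
    by (auto simp: cont_L1_def intro: set_integrable_abs)
  have "L1_norm (f + g) \<le> (LINT x:{0..}|lebesgue. \<bar>f x\<bar> + \<bar>g x\<bar>)"
    unfolding L1_norm_def by (intro set_integral_mono fg set_integral_add f g) auto
  then show ?thesis
    unfolding L1_norm_def using set_integral_add(2)[OF f g] by simp
qed

lemma Metric_space_X: "Metric_space cont_L1 dist_X"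
proof
  have half: "f - g \<in> cont_half" and diff: "f - g \<in> cont_L1"
    if "f \<in> cont_L1" "g \<in> cont_L1" for f g
    using subspace_diff[OF subspace_cont_L1 that] by (auto simp: cont_L1_def)
  show nonneg: "0 \<le> dist_X f g" for f g
  proof (cases "f \<in> cont_L1 \<and> g \<in> cont_L1")
    case True
    then show ?thesis
      using half[of f g]
      by (simp add: dist_X_eq L1_norm_nonneg suminf_nonneg summable_dist_term dist_term_nonneg)
  qed (auto simp: dist_X_def)
  show "dist_X f g = dist_X g f" for f g
    by (simp add: dist_X_def L1_norm_def sup_norm_def abs_minus_commute)
  show "dist_X f g = 0 \<longleftrightarrow> f = g" if "f \<in> cont_L1" "g \<in> cont_L1" for f g
  proof
    assume 0: "dist_X f g = 0"
    note h = half[OF that]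
    have "suminf (dist_term (f - g)) = 0"
      using 0 L1_norm_nonneg[of "f - g"]
        suminf_nonneg[OF summable_dist_term[OF h]] dist_term_nonneg[OF h]
      by (simp add: dist_X_eq[OF that] add_nonneg_eq_0_iff)
    then have t: "dist_term (f - g) k = 0" for k
      using suminf_eq_zero_iff[OF summable_dist_term[OF h]] dist_term_nonneg[OF h] by blast
    show "f = g"
    proof
      fix x
      show "f x = g x"
      proof (cases "x < 0")
        case True
        then show ?thesis using that by (simp add: cont_L1_def cont_half_def)
      next
        case False
        obtain k where k: "x \<le> real (Suc k)"
          using real_arch_simple[of x] by (meson le_SucI of_nat_mono order_trans order_refl)
        have "sup_norm (Suc k) (f - g) = 0"
          using t[of k] sup_norm_nonneg[OF h, of "Suc k"] by (simp add: dist_term_def)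
        then show ?thesis
          using abs_le_sup_norm[OF h _ k] False by simp
      qed
    qed
  next
    assume "f = g"
    then show "dist_X f g = 0"
      by (simp add: dist_X_def L1_norm_def sup_norm_def set_lebesgue_integral_def)
  qed
  show "dist_X f h \<le> dist_X f g + dist_X g h"
    if f: "f \<in> cont_L1" and g: "g \<in> cont_L1" and h: "h \<in> cont_L1" for f g h
  proof -
    have eq: "f - h = (f - g) + (g - h)" by simp
    have "dist_term (f - h) k \<le> dist_term (f - g) k + dist_term (g - h) k" for k
      unfolding dist_term_def distrib_left[symmetric]
      using sup_norm_add[OF half[OF f g] half[OF g h], of "Suc k"]
      by (intro mult_left_mono frac_mono_subadd sup_norm_nonneg half f g h) (simp_all add: eq[symmetric])
    then have "suminf (dist_term (f - h))
        \<le> suminf (\<lambda>k. dist_term (f - g) k + dist_term (g - h) k)"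
      by (intro suminf_le summable_add summable_dist_term half f g h)
    also have "\<dots> = suminf (dist_term (f - g)) + suminf (dist_term (g - h))"
      by (intro suminf_add[symmetric] summable_dist_term half f g h)
    finally show ?thesis
      using L1_norm_add[OF diff[OF f g] diff[OF g h]] f g h
      by (simp add: dist_X_eq)
  qed
qed

lemma topspace_X [simp]: "topspace topology_X = cont_L1"
  unfolding topology_X_def by (rule Metric_space.topspace_mtopology[OF Metric_space_X])

end

theory Submission
  imports Defs "HOL-Real_Asymp.Real_Asymp"
begin

text \<open>Both parts rest on one family of functions. For every real \<open>t\<close>, the \<^emph>\<open>spike function\<close>
  \<open>spike t\<close> is \<open>exp (\<alpha> x * (1 + x) powr exp t)\<close> multiplied by a bump function that equals 1 at the
  positive integers and vanishes outside tiny neighbourhoods of them. A monomial in the spikes is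
  given by the multiset \<open>p\<close> of the parameters that occur in it. At a positive integer \<open>n\<close> it takes the
  value \<open>exp (\<alpha> n * power_sum p n)\<close>, where \<open>power_sum p x\<close> adds up the powers
  \<open>(1 + x) powr exp t\<close> for \<open>t\<close> in \<open>p\<close>.

  Two distinct sums of powers of \<open>1 + x\<close> differ by a function that tends to \<open>\<infinity>\<close> or to \<open>-\<infinity>\<close>
  (\<open>power_sum_separated\<close>), so among finitely many monomials one dominates all others along the
  integers. A linear combination of distinct nonconstant monomials with nonzero coefficients is
  therefore of the exact order of one of its monomials, and this is much larger than \<open>\<alpha>\<close>
  (\<open>spike_combination_growth\<close>). Adding a function that vanishes near \<open>\<infinity>\<close> does not change that. On the
  other hand, every power sum is eventually below \<open>exp\<close>, and the bumps are so narrow that every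
  monomial is integrable nevertheless (\<open>dominated_by_spikes_integrable\<close>).

  For the strong algebrability, the nonconstant monomials form a basis of the algebra generated by the
  spikes. Hence this algebra is free, its nonzero elements have growth \<open>\<alpha>\<close>, and a finite set of
  elements involves only finitely many of the spikes, so it does not generate the algebra.

  For the dense subspace, \<open>X\<close> has the cardinality of the continuum
  (\<open>cont_L1_times_nat_lepoll_real\<close>), so every pair \<open>(g, j)\<close> of a function \<open>g \<in> X\<close> and a natural number
  \<open>j\<close> can be given its own parameter \<open>t\<close>. The subspace is spanned by functions \<open>h + \<epsilon> *\<^sub>R spike t\<close>, one
  for each pair, where \<open>h\<close> is a truncation of \<open>g\<close>, and \<open>h\<close> and \<open>\<epsilon>\<close> are chosen so that the sum
  approximates \<open>g\<close> up to \<open>1 / (j + 1)\<close>. These functions are linearly independent, since nontrivial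
  combinations have growth \<open>\<alpha>\<close>, and there are as many of them as elements of \<open>X \<times> \<nat>\<close>. Extending them to
  a basis of \<open>X\<close>, one sees that both bases have the cardinality of \<open>X\<close>.\<close>


section \<open>Finite sums with a dominant term\<close>

text \<open>Being of smaller order is transitive, so if any two members are comparable, a greatest one can be
  found by induction, as in a linear order.\<close>

lemma finite_set_has_dominant:
  fixes u :: "'k \<Rightarrow> nat \<Rightarrow> real"
  assumes "finite T" "T \<noteq> {}"
    and nz: "\<And>t n. t \<in> T \<Longrightarrow> u t n \<noteq> 0"
    and compare: "\<And>s t. s \<in> T \<Longrightarrow> t \<in> T \<Longrightarrow> s \<noteq> t \<Longrightarrow>
      (\<lambda>n. u s n / u t n) \<longlonglongrightarrow> 0 \<or> (\<lambda>n. u t n / u s n) \<longlonglongrightarrow> 0"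
  obtains d where "d \<in> T" "\<And>t. t \<in> T \<Longrightarrow> t \<noteq> d \<Longrightarrow> (\<lambda>n. u t n / u d n) \<longlonglongrightarrow> 0"
proof -
  have "\<exists>d\<in>S. \<forall>t\<in>S. t \<noteq> d \<longrightarrow> (\<lambda>n. u t n / u d n) \<longlonglongrightarrow> 0"
    if "finite S" "S \<noteq> {}" "S \<subseteq> T" for S
    using that
  proof (induction S rule: finite_ne_induct)
    case (insert s S)
    then obtain d where d: "d \<in> S" "\<forall>t\<in>S. t \<noteq> d \<longrightarrow> (\<lambda>n. u t n / u d n) \<longlonglongrightarrow> 0"
      by auto
    have "s \<noteq> d" using insert d by auto
    with compare[of s d] insert.prems d(1)
    consider "(\<lambda>n. u s n / u d n) \<longlonglongrightarrow> 0" | "(\<lambda>n. u d n / u s n) \<longlonglongrightarrow> 0" by auto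
    then show ?case
    proof cases
      case 1
      with d show ?thesis by auto
    next
      case 2
      have "(\<lambda>n. u t n / u s n) \<longlonglongrightarrow> 0" if t: "t \<in> S" for t
      proof (cases "t = d")
        case False
        have "(\<lambda>n. u t n / u d n * (u d n / u s n)) \<longlonglongrightarrow> 0 * 0"
          using d t False 2 by (intro tendsto_mult) auto
        moreover have "(\<lambda>n. u t n / u d n * (u d n / u s n)) = (\<lambda>n. u t n / u s n)"
          using nz[of d] d insert.prems by auto
        ultimately show ?thesis by (simp del: times_divide_eq_right)
      qed (use 2 in simp)
      then show ?thesis by blast
    qed
  qed simp
  from this[OF assms(1,2) order_refl] that show thesis by metis
qed

lemma sum_over_dominant_term:
  fixes u :: "'k \<Rightarrow> nat \<Rightarrow> real"
  assumes fin: "finite T" and "T \<noteq> {}" and c: "\<And>t. t \<in> T \<Longrightarrow> c t \<noteq> 0"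
    and nz: "\<And>t n. t \<in> T \<Longrightarrow> u t n \<noteq> 0"
    and compare: "\<And>s t. s \<in> T \<Longrightarrow> t \<in> T \<Longrightarrow> s \<noteq> t \<Longrightarrow>
      (\<lambda>n. u s n / u t n) \<longlonglongrightarrow> 0 \<or> (\<lambda>n. u t n / u s n) \<longlonglongrightarrow> 0"
  obtains d where "d \<in> T" "(\<lambda>n. (\<Sum>t\<in>T. c t * u t n) / u d n) \<longlonglongrightarrow> c d"
proof -
  obtain d where d: "d \<in> T" "\<And>t. t \<in> T \<Longrightarrow> t \<noteq> d \<Longrightarrow> (\<lambda>n. u t n / u d n) \<longlonglongrightarrow> 0"
    using finite_set_has_dominant[of T u, OF fin \<open>T \<noteq> {}\<close> nz compare] by blast
  have "(\<lambda>n. c t * (u t n / u d n)) \<longlonglongrightarrow> (if t = d then c d else 0)" if "t \<in> T" for t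
  proof (cases "t = d")
    case True
    then show ?thesis using nz[OF d(1)] by simp
  next
    case False
    then show ?thesis using tendsto_mult_right_zero[OF d(2)[OF that False]] by simp
  qed
  then have "(\<lambda>n. \<Sum>t\<in>T. c t * (u t n / u d n)) \<longlonglongrightarrow> (\<Sum>t\<in>T. if t = d then c d else 0)"
    by (rule tendsto_sum)
  then have "(\<lambda>n. (\<Sum>t\<in>T. c t * u t n) / u d n) \<longlonglongrightarrow> c d"
    using fin d(1) by (simp add: sum_divide_distrib)
  with d(1) that show thesis by blast
qed


section \<open>Sums of real powers\<close>

text \<open>The exponent is \<open>exp t\<close> and not \<open>t\<close>, so that every real \<open>t\<close> is admissible and all powers
  tend to \<open>\<infinity>\<close>.\<close>

definition power_sum :: "real multiset \<Rightarrow> real \<Rightarrow> real" where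
  "power_sum p x = (\<Sum>t\<in>#p. (1 + x) powr exp t)"

lemma power_sum_simps [simp]:
  "power_sum {#} x = 0"
  "power_sum (add_mset t p) x = (1 + x) powr exp t + power_sum p x"
  by (simp_all add: power_sum_def)

lemma power_sum_nonneg: "0 \<le> power_sum p x"
  by (induction p) auto

lemma power_sum_mono:
  assumes "0 \<le> x" "x \<le> y"
  shows "power_sum p x \<le> power_sum p y"
  using assms by (induction p) (auto intro!: add_mono powr_mono2)

lemma power_sum_at_top:
  assumes "p \<noteq> {#}"
  shows "filterlim (power_sum p) at_top at_top"
proof -
  obtain t q where p: "p = add_mset t q"
    using assms by (metis multiset_cases)
  have "filterlim (\<lambda>x. (1 + x) powr exp t) at_top at_top"
    by real_asymp
  then show ?thesis
    by (rule filterlim_at_top_mono) (auto simp: p power_sum_nonneg)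
qed

lemma power_sum_less_exp:
  "((\<lambda>x. power_sum p x / exp x) \<longlongrightarrow> 0) at_top"
proof (induction p)
  case (add t p)
  have "((\<lambda>x. (1 + x) powr exp t / exp x) \<longlongrightarrow> 0) at_top"
    by real_asymp
  from tendsto_add[OF this add.IH] show ?case
    by (simp add: add_divide_distrib)
qed simp

lemma power_sum_eq_sum:
  assumes "finite T" "set_mset p \<subseteq> T"
  shows "power_sum p x = (\<Sum>t\<in>T. real (count p t) * (1 + x) powr exp t)"
  using assms(2)
proof (induction p)
  case (add s p)
  have "real (count (add_mset s p) t) * (1 + x) powr exp t
      = (if t = s then (1 + x) powr exp s else 0) + real (count p t) * (1 + x) powr exp t" for t
    by (simp add: algebra_simps)
  then show ?case
    using add assms(1) by (simp add: sum.distrib del: count_add_mset mult_eq_0_iff)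
qed simp

text \<open>The difference of two distinct power sums is a nonzero linear combination of powers of \<open>1 + x\<close>
  with distinct exponents. The term with the greatest exponent determines its sign and its growth.
  Only the values at the positive integers are recorded: the spikes will be compared there.\<close>

lemma power_sum_separated:
  assumes "p \<noteq> q"
  shows "filterlim (\<lambda>n. power_sum p (real (Suc n)) - power_sum q (real (Suc n))) at_top sequentially
       \<or> filterlim (\<lambda>n. power_sum q (real (Suc n)) - power_sum p (real (Suc n))) at_top sequentially"
proof -
  define c where "c t = real (count p t) - real (count q t)" for t
  define T where "T = {t \<in> set_mset p \<union> set_mset q. c t \<noteq> 0}"
  define u where "u t n = (1 + real (Suc n)) powr exp t" for t :: real and n
  define D where "D n = power_sum p (real (Suc n)) - power_sum q (real (Suc n))" for n
  have D: "D n = (\<Sum>t\<in>T. c t * u t n)" for n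
  proof -
    let ?U = "set_mset p \<union> set_mset q"
    have "D n = (\<Sum>t\<in>?U. c t * u t n)"
      unfolding D_def c_def u_def
      by (subst (1 2) power_sum_eq_sum[of ?U])
         (auto simp: sum_subtractf left_diff_distrib)
    also have "\<dots> = (\<Sum>t\<in>T. c t * u t n)"
      by (intro sum.mono_neutral_right) (auto simp: T_def)
    finally show ?thesis .
  qed
  obtain t where "count p t \<noteq> count q t" using assms by (auto simp: multiset_eq_iff)
  then have "t \<in> T"
    by (auto simp: T_def c_def) (metis not_in_iff of_nat_0)+
  then have "T \<noteq> {}" by blast
  have smaller: "(\<lambda>n. u s n / u t n) \<longlonglongrightarrow> 0" if "s < t" for s t
  proof -
    have e: "exp s - exp t < 0" using that by simp
    have "filterlim (\<lambda>n. 1 + real (Suc n)) at_top sequentially" by real_asymp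
    from tendsto_neg_powr[OF e this] show ?thesis
      by (simp add: u_def powr_diff)
  qed
  obtain d where d: "d \<in> T" "(\<lambda>n. (\<Sum>t\<in>T. c t * u t n) / u d n) \<longlonglongrightarrow> c d"
  proof (rule sum_over_dominant_term[of T c u])
    show "(\<lambda>n. u s n / u t n) \<longlonglongrightarrow> 0 \<or> (\<lambda>n. u t n / u s n) \<longlonglongrightarrow> 0"
      if "s \<noteq> t" for s t using that smaller[of s t] smaller[of t s] by fastforce
  qed (use \<open>T \<noteq> {}\<close> in \<open>auto simp: T_def u_def\<close>)
  have top: "filterlim (u d) at_top sequentially"
    unfolding u_def by real_asymp
  have lim: "(\<lambda>n. D n / u d n) \<longlonglongrightarrow> c d" using d(2) by (simp add: D)
  have eq: "D n = D n / u d n * u d n" for n by (simp add: u_def)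
  have "c d \<noteq> 0" using d(1) by (simp add: T_def)
  then consider "c d > 0" | "- c d > 0" by linarith
  then show ?thesis
  proof cases
    case 1
    have "filterlim (\<lambda>n. D n / u d n * u d n) at_top sequentially"
      by (rule filterlim_tendsto_pos_mult_at_top[OF lim 1 top])
    then show ?thesis unfolding eq[symmetric] by (simp add: D_def)
  next
    case 2
    have "filterlim (\<lambda>n. - (D n / u d n) * u d n) at_top sequentially"
      by (rule filterlim_tendsto_pos_mult_at_top[OF tendsto_minus[OF lim] 2 top])
    then have "filterlim (\<lambda>n. - D n) at_top sequentially"
      by (subst eq) (simp only: minus_mult_left)
    then show ?thesis by (simp add: D_def)
  qed
qed


section \<open>Linear combinations of families and generated subalgebras\<close>

lemma sum_fun_apply: "(\<Sum>i\<in>I. f i) x = (\<Sum>i\<in>I. f i x)"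
  by (induction I rule: infinite_finite_induct) auto

lemma span_image_obtain_combination:
  fixes g :: "'k \<Rightarrow> 'a::real_vector"
  assumes "f \<in> span (g ` P)" and inj: "inj_on g P"
  obtains E c where "finite E" "E \<subseteq> P" "f = (\<Sum>p\<in>E. c p *\<^sub>R g p)"
proof -
  obtain F u where F: "finite F" "F \<subseteq> g ` P" and f: "f = (\<Sum>v\<in>F. u v *\<^sub>R v)"
    using assms(1) by (auto simp: span_explicit)
  from finite_subset_image[OF F] obtain E where E: "E \<subseteq> P" "finite E" "F = g ` E" by blast
  have "inj_on g E" using inj E(1) by (rule inj_on_subset)
  then have "f = (\<Sum>p\<in>E. u (g p) *\<^sub>R g p)" by (simp add: f E(3) sum.reindex)
  then show thesis by (rule that[OF E(2,1)])
qed

text \<open>Asking for nonvanishing combinations over subsets of the index set, instead of subsets of the image,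
  gives injectivity at the same time, from the combination \<open>g p - g q\<close>.\<close>

lemma independent_imageI:
  fixes g :: "'k \<Rightarrow> 'a::real_vector"
  assumes nz: "\<And>E c. finite E \<Longrightarrow> E \<subseteq> P \<Longrightarrow> \<exists>p\<in>E. c p \<noteq> 0 \<Longrightarrow> (\<Sum>p\<in>E. c p *\<^sub>R g p) \<noteq> 0"
  shows "inj_on g P" "independent (g ` P)"
proof -
  show inj: "inj_on g P"
  proof (rule inj_onI, rule ccontr)
    fix p q assume pq: "p \<in> P" "q \<in> P" "g p = g q" "p \<noteq> q"
    have "(\<Sum>r\<in>{p, q}. (if r = p then 1 else - 1) *\<^sub>R g r) \<noteq> 0"
      using pq by (intro nz) auto
    then show False using pq by simp
  qed
  show "independent (g ` P)"
    unfolding independent_explicit_module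
  proof (intro allI impI)
    fix F u v
    assume F: "finite F" "F \<subseteq> g ` P" and eq: "(\<Sum>v\<in>F. u v *\<^sub>R v) = 0" and "v \<in> F"
    from finite_subset_image[OF F] obtain E where E: "E \<subseteq> P" "finite E" "F = g ` E" by blast
    have "inj_on g E" using inj E(1) by (rule inj_on_subset)
    then have "(\<Sum>p\<in>E. u (g p) *\<^sub>R g p) = 0" using eq by (simp add: E(3) sum.reindex)
    then show "u v = 0" using nz[OF E(2,1), of "u \<circ> g"] \<open>v \<in> F\<close> E(3) by auto
  qed
qed

lemma subalgebra_Inter: "(\<And>S. S \<in> \<S> \<Longrightarrow> subalgebra S) \<Longrightarrow> subalgebra (\<Inter>\<S>)"
  unfolding subalgebra_def by (auto intro!: subspace_Inter)

lemma subalgebra_hull: "subalgebra (subalgebra hull S)"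
  by (rule hull_in) (auto intro: subalgebra_Inter)


section \<open>The metric space of continuous integrable functions\<close>

lemma cont_half_measurable:
  assumes "f \<in> cont_half"
  shows "(\<lambda>x. indicator {0..} x *\<^sub>R f x) \<in> borel_measurable lebesgue"
proof -
  have "(\<lambda>x. indicator {0..} x *\<^sub>R f x) \<in> borel_measurable borel"
    using assms by (intro borel_measurable_continuous_on_indicator) (auto simp: cont_half_def)
  then have "(\<lambda>x. indicator {0..} x *\<^sub>R f x) \<in> borel_measurable lborel" by simp
  then show ?thesis by (rule measurable_completion)
qed

lemma cont_L1_dominated:
  assumes "f \<in> cont_half" "g \<in> cont_L1" "\<And>x. 0 \<le> x \<Longrightarrow> \<bar>f x\<bar> \<le> \<bar>g x\<bar>"
  shows "f \<in> cont_L1"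
proof -
  have "integrable lebesgue (\<lambda>x. indicator {0..} x *\<^sub>R g x)"
    using assms(2) by (simp add: cont_L1_def set_integrable_def)
  then have "integrable lebesgue (\<lambda>x. indicator {0..} x *\<^sub>R f x)"
    by (rule Bochner_Integration.integrable_bound)
       (use assms(3) cont_half_measurable[OF assms(1)] in \<open>auto simp: indicator_def split: if_splits\<close>)
  then show ?thesis
    using assms(1) by (simp add: cont_L1_def set_integrable_def)
qed

lemma dist_X_translate:
  assumes "f \<in> cont_L1" "g \<in> cont_L1"
  shows "dist_X f g = dist_X (f - g) 0"
  using assms subspace_diff[OF subspace_cont_L1 assms] subspace_0[OF subspace_cont_L1]
  by (simp add: dist_X_eq)

text \<open>Dominated convergence for both parts of the metric. The integrals are dominated by \<open>\<bar>g\<bar>\<close>, and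
  the \<open>k\<close>-th term of the series by a term of the geometric series, whatever the function is (Tannery's
  theorem).\<close>

lemma dist_X_tendsto_0_dominated:
  assumes g: "g \<in> cont_L1" and h: "\<And>j. h j \<in> cont_L1"
    and bound: "\<And>j x. \<bar>h j x\<bar> \<le> \<bar>g x\<bar>"
    and sup: "\<And>n. (\<lambda>j. sup_norm n (h j)) \<longlonglongrightarrow> 0"
  shows "(\<lambda>j. dist_X (h j) 0) \<longlonglongrightarrow> 0"
proof -
  have half: "h j \<in> cont_half" for j using h by (simp add: cont_L1_def)
  have g_int: "integrable lebesgue (\<lambda>x. indicator {0..} x *\<^sub>R g x)"
    using g by (simp add: cont_L1_def set_integrable_def)
  have pointwise: "(\<lambda>j. h j x) \<longlonglongrightarrow> 0" if "0 \<le> x" for x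
  proof -
    obtain n where "x \<le> real n" using real_arch_simple by blast
    then have "\<forall>\<^sub>F j in sequentially. norm (h j x) \<le> sup_norm n (h j)"
      using that by (auto intro!: always_eventually abs_le_sup_norm half)
    then show ?thesis by (rule Lim_null_comparison) (rule sup)
  qed
  have "(\<lambda>j. LINT x|lebesgue. indicator {0..} x *\<^sub>R \<bar>h j x\<bar>)
      \<longlonglongrightarrow> (LINT x|(lebesgue :: real measure). 0 :: real)"
  proof (rule integral_dominated_convergence)
    show "integrable lebesgue (\<lambda>x. norm (indicator {0..} x *\<^sub>R g x))"
      by (rule integrable_norm[OF g_int])
    show "(\<lambda>x. indicator {0..} x *\<^sub>R \<bar>h j x\<bar>) \<in> borel_measurable lebesgue" for j
    proof -
      have "(\<lambda>x. \<bar>indicator {0..} x *\<^sub>R h j x\<bar>) \<in> borel_measurable lebesgue"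
        by (intro borel_measurable_abs cont_half_measurable half)
      moreover have "(\<lambda>x. \<bar>indicator {0..} x *\<^sub>R h j x\<bar>) = (\<lambda>x. indicator {0..} x *\<^sub>R \<bar>h j x\<bar>)"
        by (auto simp: indicator_def)
      ultimately show ?thesis by simp
    qed
    show "AE x in lebesgue. (\<lambda>j. indicator {0..} x *\<^sub>R \<bar>h j x\<bar>) \<longlonglongrightarrow> 0"
    proof (rule AE_I2)
      fix x :: real
      show "(\<lambda>j. indicator {0..} x *\<^sub>R \<bar>h j x\<bar>) \<longlonglongrightarrow> 0"
        using tendsto_rabs[OF pointwise[of x]] by (cases "0 \<le> x") auto
    qed
    show "AE x in lebesgue. norm (indicator {0..} x *\<^sub>R \<bar>h j x\<bar>) \<le> norm (indicator {0..} x *\<^sub>R g x)" for j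
      using bound by (intro AE_I2) (auto simp: indicator_def)
  qed simp
  then have L1: "(\<lambda>j. L1_norm (h j)) \<longlonglongrightarrow> 0"
    by (simp add: L1_norm_def set_lebesgue_integral_def)
  have "((\<lambda>j. suminf (\<lambda>k. dist_term (h j) k)) \<longlonglongrightarrow> suminf (\<lambda>k. 0))"
  proof (rule tannerys_theorem[THEN conjunct2, THEN conjunct2])
    show "(\<lambda>j. dist_term (h j) k) \<longlonglongrightarrow> 0" for k
    proof -
      have "(\<lambda>j. 1 / 2 ^ Suc k * (sup_norm (Suc k) (h j) / (1 + sup_norm (Suc k) (h j))))
          \<longlonglongrightarrow> 1 / 2 ^ Suc k * (0 / (1 + 0))"
        by (intro tendsto_intros sup) auto
      then show ?thesis by (simp add: dist_term_def)
    qed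
    have "norm (dist_term (h j) k) \<le> (1 / 2) ^ Suc k" for j k
    proof -
      have "dist_term (h j) k \<le> 1 / 2 ^ Suc k * 1"
        unfolding dist_term_def using sup_norm_nonneg[OF half, of "Suc k" j]
        by (intro mult_left_mono) auto
      then show ?thesis using dist_term_nonneg[OF half, of j k] by (simp add: power_one_over)
    qed
    then show "\<forall>\<^sub>F (k, j) in at_top \<times>\<^sub>F sequentially. norm (dist_term (h j) k) \<le> (1 / 2) ^ Suc k"
      by (intro always_eventually) auto
    show "summable (\<lambda>k. (1 / 2) ^ Suc k :: real)"
      by (intro summable_Suc_iff[THEN iffD2] summable_geometric) simp
  qed simp
  from tendsto_add[OF L1 this] show ?thesis
    using h subspace_0[OF subspace_cont_L1] by (simp add: dist_X_eq)
qed

lemma dist_X_scale_tendsto_0: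
  assumes "g \<in> cont_L1"
  shows "(\<lambda>j. dist_X (inverse (real (Suc j)) *\<^sub>R g) 0) \<longlonglongrightarrow> 0"
proof (rule dist_X_tendsto_0_dominated[OF assms])
  show "inverse (real (Suc j)) *\<^sub>R g \<in> cont_L1" for j
    using assms by (intro subspace_scale[OF subspace_cont_L1])
  show "\<bar>(inverse (real (Suc j)) *\<^sub>R g) x\<bar> \<le> \<bar>g x\<bar>" for j x
    by (simp add: abs_mult mult_left_le_one_le inverse_le_1_iff)
  show "(\<lambda>j. sup_norm n (inverse (real (Suc j)) *\<^sub>R g)) \<longlonglongrightarrow> 0" for n
  proof (rule tendsto_sandwich[OF always_eventually always_eventually])
    have half: "g \<in> cont_half" using assms by (simp add: cont_L1_def)
    show "\<forall>j. 0 \<le> sup_norm n (inverse (real (Suc j)) *\<^sub>R g)"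
      using half by (intro allI sup_norm_nonneg subspace_scale[OF subspace_cont_half])
    show "\<forall>j. sup_norm n (inverse (real (Suc j)) *\<^sub>R g) \<le> inverse (real (Suc j)) * sup_norm n g"
    proof
      fix j
      show "sup_norm n (inverse (real (Suc j)) *\<^sub>R g) \<le> inverse (real (Suc j)) * sup_norm n g"
        unfolding sup_norm_def[of n "inverse (real (Suc j)) *\<^sub>R g"]
        by (rule cSUP_least)
           (auto simp: abs_mult simp del: of_nat_Suc intro!: mult_left_mono abs_le_sup_norm half)
    qed
    show "(\<lambda>j. inverse (real (Suc j)) * sup_norm n g) \<longlonglongrightarrow> 0"
      by (intro tendsto_mult_left_zero LIMSEQ_inverse_real_of_nat)
  qed simp
qed

definition truncate :: "nat \<Rightarrow> (real \<Rightarrow> real) \<Rightarrow> real \<Rightarrow> real" where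
  "truncate r g x = max 0 (min 1 (real r + 1 - x)) * g x"

lemma truncate_eq_0: "real r + 1 \<le> x \<Longrightarrow> truncate r g x = 0"
  by (simp add: truncate_def)

lemma truncate_eq_self: "x \<le> real r \<Longrightarrow> truncate r g x = g x"
  by (simp add: truncate_def)

lemma truncate_cont_L1:
  assumes "g \<in> cont_L1"
  shows "truncate r g \<in> cont_L1"
proof (rule cont_L1_dominated[OF _ assms])
  show "truncate r g \<in> cont_half"
    using assms unfolding cont_L1_def cont_half_def truncate_def
    by (auto intro!: continuous_intros)
  show "\<bar>truncate r g x\<bar> \<le> \<bar>g x\<bar>" for x
    by (auto simp: truncate_def abs_mult intro!: mult_left_le_one_le)
qed

text \<open>The difference \<open>g - truncate r g\<close> vanishes on \<open>[0, n]\<close> once \<open>n \<le> r\<close>, so each supremum norm is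
  eventually 0.\<close>

lemma truncate_tendsto:
  assumes "g \<in> cont_L1"
  shows "(\<lambda>r. dist_X g (truncate r g)) \<longlonglongrightarrow> 0"
proof -
  have "(\<lambda>r. dist_X (g - truncate r g) 0) \<longlonglongrightarrow> 0"
  proof (rule dist_X_tendsto_0_dominated[OF assms])
    show "g - truncate r g \<in> cont_L1" for r
      using assms by (intro subspace_diff[OF subspace_cont_L1] truncate_cont_L1)
    show "\<bar>(g - truncate r g) x\<bar> \<le> \<bar>g x\<bar>" for r x
    proof -
      have "(g - truncate r g) x = (1 - max 0 (min 1 (real r + 1 - x))) * g x"
        by (simp add: truncate_def algebra_simps)
      then show ?thesis by (auto simp: abs_mult intro!: mult_left_le_one_le)
    qed
    show "(\<lambda>r. sup_norm n (g - truncate r g)) \<longlonglongrightarrow> 0" for n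
    proof (rule tendsto_eventually, rule eventually_sequentiallyI[of n])
      fix r assume "n \<le> r"
      then have "sup_norm n (g - truncate r g) = (SUP x\<in>{0..real n}. (0::real))"
        unfolding sup_norm_def by (intro SUP_cong) (auto simp: truncate_eq_self)
      then show "sup_norm n (g - truncate r g) = 0" by simp
    qed
  qed
  then show ?thesis
    using assms truncate_cont_L1[OF assms] by (simp add: dist_X_translate[of g])
qed

lemma cont_half_eqI:
  assumes "f \<in> cont_half" "g \<in> cont_half" and rat: "\<And>q::rat. f (of_rat q) = g (of_rat q)"
  shows "f = g"
proof (rule ccontr)
  assume "f \<noteq> g"
  then obtain x where x: "f x \<noteq> g x" by auto
  have "0 \<le> x"
  proof (rule ccontr)
    assume "\<not> 0 \<le> x"
    then show False using x assms(1,2) by (simp add: cont_half_def)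
  qed
  have "continuous_on {0..} (\<lambda>y. f y - g y)"
    using assms by (auto simp: cont_half_def intro!: continuous_intros)
  moreover have "0 < \<bar>f x - g x\<bar>" using x by simp
  ultimately have "\<exists>d>0. \<forall>y\<in>{0..}. dist y x < d \<longrightarrow> dist (f y - g y) (f x - g x) < \<bar>f x - g x\<bar>"
    using \<open>0 \<le> x\<close> unfolding continuous_on_iff by simp
  then obtain d where "d > 0"
    and d: "\<And>y. 0 \<le> y \<Longrightarrow> dist y x < d \<Longrightarrow> dist (f y - g y) (f x - g x) < \<bar>f x - g x\<bar>"
    by auto
  obtain q where q: "x < of_rat q" "of_rat q < x + d"
    using of_rat_dense[of x "x + d"] \<open>d > 0\<close> by auto
  have "dist (f (of_rat q) - g (of_rat q)) (f x - g x) < \<bar>f x - g x\<bar>"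
    using q \<open>0 \<le> x\<close> by (intro d) (linarith, simp add: dist_real_def)
  then show False by (simp add: rat dist_real_def)
qed

text \<open>A continuous function \<open>f\<close> is determined by the rational points below its graph. The set of triples
  \<open>(p, q, n)\<close> with rational \<open>p\<close> and \<open>q < f p\<close> is never empty and hence also determines \<open>n\<close>.\<close>

lemma cont_L1_times_nat_lepoll_real: "cont_L1 \<times> (UNIV :: nat set) \<lesssim> (UNIV :: real set)"
proof -
  define code where "code = (\<lambda>(f :: real \<Rightarrow> real, n :: nat).
    {to_nat (p :: rat, q :: rat, n) | p q. of_rat q < f (of_rat p)})"
  have mem: "to_nat (p :: rat, q :: rat, m) \<in> code (f, n) \<longleftrightarrow> m = n \<and> of_rat q < f (of_rat p)"
    for p q m f n by (auto simp: code_def)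
  have "inj_on code (cont_L1 \<times> UNIV)"
  proof (rule inj_onI, clarify)
    fix f g :: "real \<Rightarrow> real" and m n :: nat
    assume "f \<in> cont_L1" "g \<in> cont_L1" and eq: "code (f, m) = code (g, n)"
    obtain q where "of_rat q < f (of_rat 0)" using of_rat_dense[of "f (of_rat 0) - 1" "f (of_rat 0)"] by auto
    then have "m = n" using mem[of 0 q m f m] mem[of 0 q m g n] eq by auto
    have "f (of_rat p) = g (of_rat p)" for p
    proof (rule ccontr)
      assume "f (of_rat p) \<noteq> g (of_rat p)"
      then consider "f (of_rat p) < g (of_rat p)" | "g (of_rat p) < f (of_rat p)" by linarith
      then show False
      proof cases
        case 1
        then obtain q where "f (of_rat p) < of_rat q" "of_rat q < g (of_rat p)" using of_rat_dense by blast
        then show False using mem[of p q m f m] mem[of p q m g n] eq \<open>m = n\<close> by auto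
      next
        case 2
        then obtain q where "g (of_rat p) < of_rat q" "of_rat q < f (of_rat p)" using of_rat_dense by blast
        then show False using mem[of p q m f m] mem[of p q m g n] eq \<open>m = n\<close> by auto
      qed
    qed
    then have "f = g"
      using \<open>f \<in> cont_L1\<close> \<open>g \<in> cont_L1\<close> by (intro cont_half_eqI) (auto simp: cont_L1_def)
    with \<open>m = n\<close> show "f = g \<and> m = n" by simp
  qed
  then have "cont_L1 \<times> (UNIV :: nat set) \<lesssim> (UNIV :: nat set set)"
    unfolding lepoll_def by blast
  with nat_sets_eqpoll_reals show ?thesis
    by (meson eqpoll_imp_lepoll lepoll_trans)
qed


section \<open>Spikes\<close>

locale growth_weight =
  fixes \<alpha> :: "real \<Rightarrow> real"
  assumes weight_cont: "continuous_on {0..} \<alpha>"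
    and weight_mono: "mono_on {0..} \<alpha>"
    and weight_ge_1: "\<And>x. 0 \<le> x \<Longrightarrow> 1 \<le> \<alpha> x"
begin

lemma weight_le: "0 \<le> x \<Longrightarrow> x \<le> y \<Longrightarrow> \<alpha> x \<le> \<alpha> y"
  using weight_mono by (auto intro: mono_onD)

text \<open>The shift by 2 compensates for the width of the bumps: near \<open>k + 1\<close> the argument may be any point of
  \<open>[k, k + 2]\<close>, and the steepness at \<open>k\<close> has to beat the height of a spike at \<open>k + 2\<close>.\<close>

definition steepness :: "real \<Rightarrow> real" where
  "steepness x = exp (\<alpha> (x + 2) * exp (x + 2))"

definition bump :: "real \<Rightarrow> real" where
  "bump x = max 0 (1 - steepness x * infdist x (real ` {1..}))"

definition spike :: "real \<Rightarrow> real \<Rightarrow> real" where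
  "spike t x = (if x < 0 then 0 else exp (\<alpha> x * (1 + x) powr exp t) * bump x)"

definition spike_monomial :: "real multiset \<Rightarrow> real \<Rightarrow> real" where
  "spike_monomial p = (\<Prod>t\<in>#p. spike t)"

lemma steepness_ge_1: "0 \<le> x \<Longrightarrow> 1 \<le> steepness x"
  using weight_ge_1[of "x + 2"] by (simp add: steepness_def)

lemma steepness_mono:
  assumes "0 \<le> x" "x \<le> y"
  shows "steepness x \<le> steepness y"
  using assms weight_le[of "x + 2" "y + 2"] weight_ge_1[of "x + 2"]
  by (auto simp: steepness_def intro!: mult_mono)

lemma bump_cont: "continuous_on {0..} bump"
proof -
  have "continuous_on {0..} (\<lambda>x. \<alpha> (x + 2))"
    by (rule continuous_on_compose2[OF weight_cont]) (auto intro!: continuous_intros)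
  then show ?thesis
    unfolding bump_def[abs_def] steepness_def by (auto intro!: continuous_intros)
qed

lemma bump_nonneg: "0 \<le> bump x"
  by (simp add: bump_def)

lemma bump_le_1:
  assumes "0 \<le> x"
  shows "bump x \<le> 1"
  using steepness_ge_1[OF assms] infdist_nonneg[of x "real ` {1..}"] by (simp add: bump_def)

lemma bump_Suc: "bump (real (Suc n)) = 1"
proof -
  have "infdist (real (Suc n)) (real ` {1..}) = 0"
    by (rule infdist_zero) (rule imageI, simp)
  then show ?thesis by (simp add: bump_def)
qed

text \<open>If \<open>k + 1\<close> is the nearest positive integer to \<open>x\<close>, then \<open>steepness x \<ge> 1\<close> first gives \<open>k \<le> x\<close>, and
  then the bound \<open>1 / steepness x\<close> on the distance improves to one that depends on \<open>k\<close> only.\<close>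

lemma bump_support:
  assumes "0 \<le> x" "bump x \<noteq> 0"
  obtains k :: nat where "\<bar>x - real (Suc k)\<bar> \<le> 1 / steepness k" "x \<le> real k + 2"
proof -
  have "real ` {1..} \<subseteq> \<int>" by auto
  then obtain a where "a \<in> real ` {1..}" and a: "infdist x (real ` {1..}) = dist x a"
    using infdist_attains_inf[of "real ` {1..}" x] closed_subset_Ints by blast
  then obtain n :: nat where "1 \<le> n" "a = real n" by auto
  then have "a = real (Suc (n - 1))" by auto
  define k where "k = n - 1"
  have ak: "a = real k + 1" using \<open>a = real (Suc (n - 1))\<close> by (simp add: k_def)
  have near: "steepness x * \<bar>x - a\<bar> < 1"
    using assms(2) a by (auto simp: bump_def dist_real_def max_def split: if_splits)
  have "\<bar>x - a\<bar> \<le> steepness x * \<bar>x - a\<bar>"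
    using steepness_ge_1[OF assms(1)] by (simp add: mult_le_cancel_right1)
  with near have "\<bar>x - a\<bar> < 1" by simp
  then have kx: "real k \<le> x" "x \<le> real k + 2" by (auto simp: ak)
  have "steepness k * \<bar>x - a\<bar> \<le> steepness x * \<bar>x - a\<bar>"
    using kx by (intro mult_right_mono steepness_mono) auto
  with near have "\<bar>x - a\<bar> \<le> 1 / steepness k"
    using steepness_ge_1[of k] by (simp add: field_simps)
  with kx(2) show thesis by (intro that[of k]) (auto simp: ak add.commute)
qed

text \<open>The \<open>k\<close>-th term bounds the area below a monomial near \<open>k + 1\<close>. With \<open>z = k + 2\<close> it is twice the
  exponential of \<open>\<alpha> z * (power_sum p z - exp z)\<close>, and eventually \<open>power_sum p z + z \<le> exp z\<close>.\<close>

lemma spike_bound_summable: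
  "summable (\<lambda>k. exp (\<alpha> (real k + 2) * power_sum p (real k + 2)) * (2 / steepness k))"
proof (rule summable_comparison_test_ev)
  have "((\<lambda>z. power_sum p z / exp z + z / exp z) \<longlongrightarrow> 0 + 0) at_top"
    by (intro tendsto_add power_sum_less_exp) real_asymp
  then have "\<forall>\<^sub>F z in at_top. power_sum p z / exp z + z / exp z < 1"
    by (intro order_tendstoD) auto
  moreover have "filterlim (\<lambda>k. real k + 2) at_top sequentially" by real_asymp
  ultimately have ev: "\<forall>\<^sub>F k in sequentially.
      power_sum p (real k + 2) / exp (real k + 2) + (real k + 2) / exp (real k + 2) < 1"
    by (rule eventually_compose_filterlim)
  show "\<forall>\<^sub>F k in sequentially.
      norm (exp (\<alpha> (real k + 2) * power_sum p (real k + 2)) * (2 / steepness k)) \<le> 2 * exp (- 1) ^ k"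
    using ev
  proof eventually_elim
    case (elim k)
    define z where "z = real k + 2"
    have "power_sum p z + z \<le> exp z"
      using elim by (simp add: z_def[symmetric] add_divide_distrib[symmetric] field_simps)
    then have "\<alpha> z * (power_sum p z - exp z) \<le> \<alpha> z * (- z)"
      using weight_ge_1[of z] by (intro mult_left_mono) (auto simp: z_def)
    also have "\<dots> \<le> - z"
      using weight_ge_1[of z] by (simp add: z_def)
    also have "\<dots> \<le> - real k" by (simp add: z_def)
    finally have "exp (\<alpha> z * power_sum p z - \<alpha> z * exp z) \<le> exp (- real k)"
      by (simp add: right_diff_distrib)
    then have "exp (\<alpha> z * power_sum p z) / steepness k \<le> exp (- real k)"
      by (simp add: steepness_def z_def exp_diff)
    then show ?case
      by (simp add: steepness_def z_def[symmetric] exp_of_nat_mult[symmetric] field_simps)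
  qed
  show "summable (\<lambda>k. 2 * exp (- 1 :: real) ^ k)"
    by (intro summable_mult summable_geometric) simp
qed

text \<open>The function is bounded by a sum of step functions, the \<open>k\<close>-th of which is constant on the interval of
  radius \<open>1 / steepness k\<close> around \<open>k + 1\<close>. Their total area is finite by
  \<open>spike_bound_summable\<close>.\<close>

lemma dominated_by_spikes_integrable:
  assumes f: "f \<in> cont_half"
    and bound: "\<And>x. 0 \<le> x \<Longrightarrow> \<bar>f x\<bar> \<le> exp (\<alpha> x * power_sum p x) * bump x"
  shows "f \<in> cont_L1"
proof -
  define height where "height k = exp (\<alpha> (real k + 2) * power_sum p (real k + 2))" for k :: nat
  define S where "S k = {real (Suc k) - 1 / steepness k .. real (Suc k) + 1 / steepness k}" for k :: nat
  have term_le_suminf: "a k \<le> suminf a" for a :: "nat \<Rightarrow> ennreal" and k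
    using sum_le_suminf[of a "{k}"] by simp
  have pointwise: "ennreal (norm (indicator {0..} x *\<^sub>R f x)) \<le> suminf (\<lambda>k. ennreal (height k) * indicator (S k) x)"
    for x
  proof (cases "0 \<le> x \<and> bump x \<noteq> 0")
    case True
    then obtain k :: nat where k: "\<bar>x - real (Suc k)\<bar> \<le> 1 / steepness k" "x \<le> real k + 2"
      using bump_support by blast
    have "\<bar>f x\<bar> \<le> exp (\<alpha> x * power_sum p x) * 1"
      using True by (intro order_trans[OF bound[of x]] mult_left_mono bump_le_1) auto
    also have "\<alpha> x * power_sum p x \<le> \<alpha> (real k + 2) * power_sum p (real k + 2)"
      using True k(2) weight_ge_1[of "real k + 2"]
      by (intro mult_mono weight_le power_sum_mono) (auto simp: power_sum_nonneg)
    finally have "\<bar>f x\<bar> \<le> height k" by (simp add: height_def)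
    moreover have "x \<in> S k" using k(1) by (auto simp: S_def abs_le_iff)
    ultimately have "ennreal (norm (indicator {0..} x *\<^sub>R f x)) \<le> ennreal (height k) * indicator (S k) x"
      using True by (simp add: ennreal_leI)
    also have "\<dots> \<le> suminf (\<lambda>k. ennreal (height k) * indicator (S k) x)"
      by (rule term_le_suminf[where a = "\<lambda>k. ennreal (height k) * indicator (S k) x"])
    finally show ?thesis .
  next
    case False
    then have "indicator {0..} x *\<^sub>R f x = 0" using bound[of x] by (auto simp: indicator_def)
    then show ?thesis by (simp only: norm_zero ennreal_0 zero_le)
  qed
  have "(\<integral>\<^sup>+x. ennreal (norm (indicator {0..} x *\<^sub>R f x)) \<partial>lebesgue)
      \<le> (\<integral>\<^sup>+x. suminf (\<lambda>k. ennreal (height k) * indicator (S k) x) \<partial>lebesgue)"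
    by (intro nn_integral_mono pointwise)
  also have "\<dots> = suminf (\<lambda>k. \<integral>\<^sup>+x. ennreal (height k) * indicator (S k) x \<partial>lebesgue)"
    by (intro nn_integral_suminf borel_measurable_times_ennreal borel_measurable_const
        borel_measurable_indicator) (simp add: S_def)
  also have "\<dots> = suminf (\<lambda>k. ennreal (height k * (2 / steepness k)))"
  proof (intro suminf_cong)
    fix k :: nat
    have "(\<integral>\<^sup>+x. ennreal (height k) * indicator (S k) x \<partial>lebesgue) = ennreal (height k) * emeasure lebesgue (S k)"
      by (intro nn_integral_cmult_indicator) (simp add: S_def)
    also have "emeasure lebesgue (S k) = ennreal (2 / steepness k)"
      using steepness_ge_1[of k] by (simp add: S_def)
    finally show "(\<integral>\<^sup>+x. ennreal (height k) * indicator (S k) x \<partial>lebesgue) = ennreal (height k * (2 / steepness k))"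
      using steepness_ge_1[of k] by (simp add: height_def ennreal_mult del: times_divide_eq_right)
  qed
  also have "\<dots> < \<infinity>"
  proof -
    have "suminf (\<lambda>k. ennreal (height k * (2 / steepness k))) \<noteq> top"
      unfolding height_def using spike_bound_summable
      by (intro ennreal_suminf_neq_top) (auto simp: steepness_def)
    then show ?thesis by (simp add: less_top)
  qed
  finally have "integrable lebesgue (\<lambda>x. indicator {0..} x *\<^sub>R f x)"
    by (intro integrableI_bounded cont_half_measurable f)
  then show ?thesis using f by (simp add: cont_L1_def set_integrable_def)
qed

lemma spike_cont_half: "spike t \<in> cont_half"
proof -
  have "continuous_on {0..} (\<lambda>x. exp (\<alpha> x * (1 + x) powr exp t) * bump x)"
    by (intro continuous_intros weight_cont bump_cont) auto
  then have "continuous_on {0..} (spike t)"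
    by (rule continuous_on_eq) (simp add: spike_def)
  then show ?thesis by (simp add: cont_half_def spike_def)
qed

lemma spike_monomial_simps [simp]:
  "spike_monomial {#} = 1"
  "spike_monomial (add_mset t p) = spike t * spike_monomial p"
  "spike_monomial (p + q) = spike_monomial p * spike_monomial q"
  by (simp_all add: spike_monomial_def)

lemma spike_monomial_eq:
  "0 \<le> x \<Longrightarrow> spike_monomial p x = exp (\<alpha> x * power_sum p x) * bump x ^ size p"
  by (induction p) (auto simp: spike_def distrib_left exp_add)

lemma spike_monomial_Suc:
  "spike_monomial p (real (Suc n)) = exp (\<alpha> (real (Suc n)) * power_sum p (real (Suc n)))"
  using spike_monomial_eq[of "real (Suc n)" p] bump_Suc[of n] by simp

lemma spike_monomial_cont_half:
  assumes "p \<noteq> {#}"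
  shows "spike_monomial p \<in> cont_half"
  using assms
proof (induction p)
  case (add t p)
  show ?case
  proof (cases "p = {#}")
    case True
    then show ?thesis using spike_cont_half[of t] by (simp add: mult_1_right)
  next
    case False
    with add.IH show ?thesis
      using spike_cont_half[of t] subalgebra_cont_half
      unfolding subalgebra_def spike_monomial_simps by blast
  qed
qed simp

lemma spike_monomial_cont_L1:
  assumes "p \<noteq> {#}"
  shows "spike_monomial p \<in> cont_L1"
proof (rule dominated_by_spikes_integrable[OF spike_monomial_cont_half[OF assms]])
  fix x :: real assume "0 \<le> x"
  obtain n where n: "size p = Suc n" using assms by (cases "size p") auto
  have "bump x ^ Suc n \<le> bump x"
    using power_decreasing[of 1 "Suc n" "bump x"] bump_nonneg bump_le_1[OF \<open>0 \<le> x\<close>] by simp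
  then show "\<bar>spike_monomial p x\<bar> \<le> exp (\<alpha> x * power_sum p x) * bump x"
    using \<open>0 \<le> x\<close> bump_nonneg[of x] by (simp add: spike_monomial_eq n abs_mult)
qed


section \<open>Growth of combinations of spikes\<close>

lemma growth_setI:
  assumes "f \<in> cont_L1"
    and top: "filterlim (\<lambda>n. \<bar>f (real (Suc n))\<bar> / \<alpha> (real (Suc n))) at_top sequentially"
  shows "f \<in> growth_set \<alpha>"
proof -
  let ?L = "Limsup at_top (\<lambda>x. ereal (\<bar>f x\<bar> / \<alpha> x))"
  have "?L = \<infinity>"
  proof (rule ccontr)
    assume "?L \<noteq> \<infinity>"
    then obtain c where "?L < ereal c"
      using less_PInf_Ex_of_nat[of ?L] by auto
    then have "\<forall>\<^sub>F x in at_top. ereal (\<bar>f x\<bar> / \<alpha> x) < ereal c"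
      by (rule Limsup_lessD)
    moreover have "filterlim (\<lambda>n. real (Suc n)) at_top sequentially" by real_asymp
    ultimately have "\<forall>\<^sub>F n in sequentially. ereal (\<bar>f (real (Suc n))\<bar> / \<alpha> (real (Suc n))) < ereal c"
      by (rule eventually_compose_filterlim)
    moreover have "\<forall>\<^sub>F n in sequentially. c \<le> \<bar>f (real (Suc n))\<bar> / \<alpha> (real (Suc n))"
      using top by (simp add: filterlim_at_top)
    ultimately have "\<forall>\<^sub>F n in sequentially. False"
      by eventually_elim simp
    then show False by simp
  qed
  with assms(1) show ?thesis by (simp add: growth_set_def)
qed

text \<open>Along the positive integers the function \<open>g\<close> disappears and the sum is of the order of its dominant
  monomial. That one is of larger order than \<open>\<alpha>\<close>, because \<open>exp (\<alpha> n * y) / \<alpha> n \<ge> y\<close> for \<open>y = power_sum d n\<close>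
  and \<open>power_sum d\<close> tends to \<open>\<infinity>\<close>. Comparing two monomials uses \<open>\<alpha> \<ge> 1\<close>: the factor \<open>\<alpha> n\<close> only
  enlarges the difference of the exponents.\<close>

lemma spike_combination_growth:
  assumes fin: "finite E" and "E \<noteq> {}" and E: "\<And>p. p \<in> E \<Longrightarrow> p \<noteq> {#} \<and> c p \<noteq> 0"
    and g: "g \<in> cont_L1" and g0: "\<forall>\<^sub>F x in at_top. g x = 0"
  shows "(\<Sum>p\<in>E. c p *\<^sub>R spike_monomial p) + g \<in> growth_set \<alpha>"
proof (rule growth_setI)
  let ?f = "(\<Sum>p\<in>E. c p *\<^sub>R spike_monomial p) + g"
  show "?f \<in> cont_L1"
    using E by (intro subspace_add[OF subspace_cont_L1] subspace_sum[OF subspace_cont_L1]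
        subspace_scale[OF subspace_cont_L1] spike_monomial_cont_L1 g) auto
  define a where "a n = \<alpha> (real (Suc n))" for n
  define u where "u p n = exp (a n * power_sum p (real (Suc n)))" for p n
  have a: "1 \<le> a n" for n unfolding a_def by (rule weight_ge_1) simp
  have smaller: "(\<lambda>n. u p n / u q n) \<longlonglongrightarrow> 0"
    if "filterlim (\<lambda>n. power_sum q (real (Suc n)) - power_sum p (real (Suc n))) at_top sequentially"
    for p q
  proof -
    let ?D = "\<lambda>n. power_sum q (real (Suc n)) - power_sum p (real (Suc n))"
    have "\<forall>\<^sub>F n in sequentially. 0 \<le> ?D n"
      using that unfolding filterlim_at_top by blast
    then have "\<forall>\<^sub>F n in sequentially. ?D n \<le> a n * ?D n"
    proof eventually_elim
      case (elim n)
      then show ?case using mult_right_mono[OF a[of n] elim] by simp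
    qed
    then have "filterlim (\<lambda>n. a n * ?D n) at_top sequentially"
      by (rule filterlim_at_top_mono[OF that])
    then have "filterlim (\<lambda>n. - (a n * ?D n)) at_bot sequentially"
      by (simp add: filterlim_uminus_at_top)
    then have "(\<lambda>n. exp (- (a n * ?D n))) \<longlonglongrightarrow> 0"
      by (rule filterlim_compose[OF exp_at_bot])
    moreover have "exp (- (a n * ?D n)) = u p n / u q n" for n
      by (simp add: u_def exp_diff[symmetric] right_diff_distrib)
    ultimately show ?thesis by simp
  qed
  obtain d where d: "d \<in> E" "(\<lambda>n. (\<Sum>p\<in>E. c p * u p n) / u d n) \<longlonglongrightarrow> c d"
  proof (rule sum_over_dominant_term[of E c u])
    show "(\<lambda>n. u p n / u q n) \<longlonglongrightarrow> 0 \<or> (\<lambda>n. u q n / u p n) \<longlonglongrightarrow> 0"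
      if "p \<noteq> q" for p q
      using power_sum_separated[OF that] smaller by blast
  qed (use fin \<open>E \<noteq> {}\<close> E in \<open>auto simp: u_def\<close>)
  have "filterlim (\<lambda>n. power_sum d (real (Suc n))) at_top sequentially"
  proof (rule filterlim_compose[OF power_sum_at_top])
    show "d \<noteq> {#}" using d(1) E by blast
  qed real_asymp
  moreover have "power_sum d (real (Suc n)) \<le> u d n / a n" for n
  proof -
    have "a n * power_sum d (real (Suc n)) \<le> u d n"
      unfolding u_def using exp_ge_add_one_self[of "a n * power_sum d (real (Suc n))"] by linarith
    then show ?thesis using a[of n] by (simp add: field_simps)
  qed
  ultimately have top: "filterlim (\<lambda>n. u d n / a n) at_top sequentially"
    by (rule filterlim_at_top_mono[OF _ always_eventually, rule_format])
  have "filterlim (\<lambda>n. \<bar>(\<Sum>p\<in>E. c p * u p n) / u d n\<bar> * (u d n / a n)) at_top sequentially"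
    using E d(1) by (intro filterlim_tendsto_pos_mult_at_top[OF tendsto_rabs[OF d(2)] _ top]) auto
  then show "filterlim (\<lambda>n. \<bar>?f (real (Suc n))\<bar> / \<alpha> (real (Suc n))) at_top sequentially"
  proof (rule filterlim_mono_eventually[OF _ order_refl order_refl])
    have "filterlim (\<lambda>n. real (Suc n)) at_top sequentially" by real_asymp
    with g0 have "\<forall>\<^sub>F n in sequentially. g (real (Suc n)) = 0"
      by (rule eventually_compose_filterlim)
    then show "\<forall>\<^sub>F n in sequentially. \<bar>(\<Sum>p\<in>E. c p * u p n) / u d n\<bar> * (u d n / a n)
        = \<bar>?f (real (Suc n))\<bar> / \<alpha> (real (Suc n))"
    proof eventually_elim
      case (elim n)
      have "?f (real (Suc n)) = (\<Sum>p\<in>E. c p * u p n)"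
        using elim by (simp add: sum_fun_apply spike_monomial_Suc u_def a_def del: of_nat_Suc)
      then show ?case by (simp add: a_def u_def del: of_nat_Suc)
    qed
  qed
qed

corollary spike_combination_growth_if_nonzero:
  assumes fin: "finite E" and E: "{#} \<notin> E" and c: "\<exists>p\<in>E. c p \<noteq> 0"
    and g: "g \<in> cont_L1" "\<forall>\<^sub>F x in at_top. g x = 0"
  shows "(\<Sum>p\<in>E. c p *\<^sub>R spike_monomial p) + g \<in> growth_set \<alpha>"
proof -
  define E' where "E' = {p \<in> E. c p \<noteq> 0}"
  have "(\<Sum>p\<in>E. c p *\<^sub>R spike_monomial p) = (\<Sum>p\<in>E'. c p *\<^sub>R spike_monomial p)"
    using fin by (intro sum.mono_neutral_right) (auto simp: E'_def)
  moreover have "(\<Sum>p\<in>E'. c p *\<^sub>R spike_monomial p) + g \<in> growth_set \<alpha>"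
    using fin E c by (intro spike_combination_growth g) (auto simp: E'_def)
  ultimately show ?thesis by simp
qed

lemma growth_set_nonzero: "f \<in> growth_set \<alpha> \<Longrightarrow> f \<noteq> 0"
  by (auto simp: growth_set_def Limsup_const)


section \<open>The algebra generated by the spikes\<close>

lemma spike_combination_nonzero:
  assumes "finite E" "E \<subseteq> - {{#}}" "\<exists>p\<in>E. c p \<noteq> 0"
  shows "(\<Sum>p\<in>E. c p *\<^sub>R spike_monomial p) \<in> growth_set \<alpha>"
    and "(\<Sum>p\<in>E. c p *\<^sub>R spike_monomial p) \<noteq> 0"
proof -
  have "(\<Sum>p\<in>E. c p *\<^sub>R spike_monomial p) + 0 \<in> growth_set \<alpha>"
    using assms subspace_0[OF subspace_cont_L1]
    by (intro spike_combination_growth_if_nonzero) auto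
  then show growth: "(\<Sum>p\<in>E. c p *\<^sub>R spike_monomial p) \<in> growth_set \<alpha>"
    by (simp only: add_0_right)
  show "(\<Sum>p\<in>E. c p *\<^sub>R spike_monomial p) \<noteq> 0"
    using growth by (rule growth_set_nonzero)
qed

lemma spike_monomial_inj: "inj_on spike_monomial (- {{#}})"
  and independent_spike_monomials: "independent (spike_monomial ` (- {{#}}))"
  using independent_imageI[of "- {{#}}" spike_monomial] spike_combination_nonzero(2) by auto

definition spike_algebra :: "(real \<Rightarrow> real) set" where
  "spike_algebra = span (spike_monomial ` (- {{#}}))"

lemma spike_algebra_growth: "spike_algebra - {0} \<subseteq> growth_set \<alpha>"
proof
  fix f assume f: "f \<in> spike_algebra - {0}"
  then have "f \<in> span (spike_monomial ` (- {{#}}))" by (simp add: spike_algebra_def)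
  from span_image_obtain_combination[OF this spike_monomial_inj]
  obtain E c where E: "finite E" "E \<subseteq> - {{#}}" "f = (\<Sum>p\<in>E. c p *\<^sub>R spike_monomial p)" .
  have "\<exists>p\<in>E. c p \<noteq> 0"
  proof (rule ccontr)
    assume "\<not> (\<exists>p\<in>E. c p \<noteq> 0)"
    then have "f = 0" by (simp add: E(3))
    with f show False by simp
  qed
  with E show "f \<in> growth_set \<alpha>" using spike_combination_nonzero(1) by simp
qed

text \<open>Stated for an arbitrary additively closed set of monomials, as it serves both for the whole algebra
  and for the subalgebra of combinations over a finite set of spikes.\<close>

lemma subalgebra_span_spike_monomials:
  assumes P: "\<And>p q. p \<in> P \<Longrightarrow> q \<in> P \<Longrightarrow> p + q \<in> P"
  shows "subalgebra (span (spike_monomial ` P))"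
  unfolding subalgebra_def
proof (intro conjI ballI subspace_span)
  let ?S = "span (spike_monomial ` P)"
  \<comment> \<open>Multiplication is bilinear, so it suffices to treat one factor after the other.\<close>
  have mono: "spike_monomial p * g \<in> ?S" if "p \<in> P" "g \<in> ?S" for p g
    using that(2)
  proof (induction rule: span_induct_alt)
    case base
    show ?case unfolding mult_zero_right by (rule span_zero)
  next
    case (step c h g)
    then obtain q where "q \<in> P" "h = spike_monomial q" by auto
    then have "spike_monomial p * h \<in> ?S"
      using P[OF \<open>p \<in> P\<close>] by (metis imageI span_base spike_monomial_simps(3))
    with step show ?case
      by (simp only: distrib_left mult_scaleR_right) (intro span_add span_scale)
  qed
  fix f g assume "f \<in> ?S" "g \<in> ?S"
  from this(1) show "f * g \<in> ?S"
  proof (induction rule: span_induct_alt)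
    case base
    show ?case unfolding mult_zero_left by (rule span_zero)
  next
    case (step c h f)
    then have "h * g \<in> ?S" using mono \<open>g \<in> ?S\<close> by auto
    with step show ?case
      by (simp only: distrib_right mult_scaleR_left) (intro span_add span_scale)
  qed
qed

lemma subalgebra_spike_algebra: "subalgebra spike_algebra"
  unfolding spike_algebra_def by (rule subalgebra_span_spike_monomials) auto

lemma spike_monomial_in_hull:
  assumes "p \<noteq> {#}"
  shows "spike_monomial p \<in> subalgebra hull (range spike)"
  using assms
proof (induction p)
  case (add t p)
  have gen: "spike t \<in> subalgebra hull (range spike)" by (intro hull_inc) simp
  note sub = subalgebra_hull[of "range spike"]
  show ?case
  proof (cases "p = {#}")
    case True
    then show ?thesis using gen by (simp add: mult_1_right)
  next
    case False
    with add.IH gen sub show ?thesis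
      unfolding subalgebra_def spike_monomial_simps by blast
  qed
qed simp

lemma hull_spikes: "subalgebra hull (range spike) = spike_algebra"
proof
  have "range spike \<subseteq> spike_algebra"
  proof safe
    fix t
    have "spike t = spike_monomial {#t#}" by (simp add: mult_1_right)
    also have "\<dots> \<in> spike_algebra" unfolding spike_algebra_def by (intro span_base imageI) simp
    finally show "spike t \<in> spike_algebra" .
  qed
  then show "subalgebra hull (range spike) \<subseteq> spike_algebra"
    by (rule hull_minimal) (rule subalgebra_spike_algebra)
  note sub = subalgebra_hull[of "range spike"]
  show "spike_algebra \<subseteq> subalgebra hull (range spike)"
    unfolding spike_algebra_def
    by (rule span_minimal) (use spike_monomial_in_hull sub in \<open>auto simp: subalgebra_def\<close>)
qed

lemma spike_algebra_cont_half: "spike_algebra \<subseteq> cont_half"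
  unfolding spike_algebra_def
  by (rule span_minimal) (use spike_monomial_cont_half subspace_cont_half in auto)

text \<open>The exponent vector \<open>m\<close>, applied to the generators \<open>spike (t 0), spike (t 1), \<dots>\<close>, as a multiset of
  parameters.\<close>

definition substitute :: "(nat \<Rightarrow> real) \<Rightarrow> (nat \<Rightarrow>\<^sub>0 nat) \<Rightarrow> real multiset" where
  "substitute t m = (\<Sum>i\<in>Poly_Mapping.keys m. replicate_mset (Poly_Mapping.lookup m i) (t i))"

lemma spike_monomial_sum:
  "spike_monomial (\<Sum>i\<in>I. p i) = (\<Prod>i\<in>I. spike_monomial (p i))"
  by (induction I rule: infinite_finite_induct) auto

lemma spike_monomial_replicate: "spike_monomial (replicate_mset n t) = spike t ^ n"
  by (induction n) auto

lemma spike_monomial_substitute: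
  "spike_monomial (substitute t m) = (\<Prod>i\<in>Poly_Mapping.keys m. spike (t i) ^ Poly_Mapping.lookup m i)"
  by (simp add: substitute_def spike_monomial_sum spike_monomial_replicate)

lemma count_substitute:
  assumes "inj_on t {..<s}" "Poly_Mapping.keys m \<subseteq> {..<s}" "i < s"
  shows "count (substitute t m) (t i) = Poly_Mapping.lookup m i"
proof -
  have "count (substitute t m) (t i)
      = (\<Sum>j\<in>Poly_Mapping.keys m. if j = i then Poly_Mapping.lookup m i else 0)"
    unfolding substitute_def count_sum
    using assms by (intro sum.cong) (auto dest: inj_onD)
  then show ?thesis by (simp add: in_keys_iff)
qed

lemma substitute_inj:
  assumes "inj_on t {..<s}" "Poly_Mapping.keys m \<subseteq> {..<s}" "Poly_Mapping.keys m' \<subseteq> {..<s}"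
    and "substitute t m = substitute t m'"
  shows "m = m'"
proof (rule poly_mapping_eqI)
  fix i
  show "Poly_Mapping.lookup m i = Poly_Mapping.lookup m' i"
  proof (cases "i < s")
    case True
    then show ?thesis using count_substitute[OF assms(1)] assms by metis
  next
    case False
    then have "i \<notin> Poly_Mapping.keys m" "i \<notin> Poly_Mapping.keys m'" using assms by auto
    then show ?thesis by (simp add: in_keys_iff)
  qed
qed

lemma substitute_nonempty:
  assumes "m \<noteq> 0"
  shows "substitute t m \<noteq> {#}"
proof -
  obtain i where "i \<in> Poly_Mapping.keys m" using assms by fastforce
  then show ?thesis
    using sum.remove[OF finite_keys, of i m "\<lambda>i. replicate_mset (Poly_Mapping.lookup m i) (t i)"]
    by (auto simp: substitute_def in_keys_iff)
qed

text \<open>Substituting distinct spikes turns distinct monomials of a polynomial into distinct monomials in the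
  spikes, so a nonzero polynomial without constant term becomes a nontrivial combination of
  nonconstant monomials.\<close>

lemma free_generators_spikes: "free_generators spike_algebra (range spike)"
  unfolding free_generators_def
proof (intro conjI hull_spikes allI impI, elim conjE)
  fix s P and f :: "nat \<Rightarrow> real \<Rightarrow> real"
  assume P: "poly_in s P" "P \<noteq> 0" "const_term P = 0" and f: "inj_on f {..<s}" "f ` {..<s} \<subseteq> range spike"
  define t where "t i = (SOME r. f i = spike r)" for i
  have t: "f i = spike (t i)" if "i < s" for i
  proof -
    have "\<exists>r. f i = spike r" using f(2) that by auto
    then show ?thesis unfolding t_def by (rule someI_ex)
  qed
  have t_inj: "inj_on t {..<s}"
    using f(1) t by (auto simp: inj_on_def)
  have keys: "Poly_Mapping.keys m \<subseteq> {..<s}" if "m \<in> Poly_Mapping.keys P" for m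
    using P(1) that by (simp add: poly_in_def)
  have nonzero: "m \<noteq> 0" if "m \<in> Poly_Mapping.keys P" for m
    using P(3) that by (auto simp: in_keys_iff)
  have inj: "inj_on (substitute t) (Poly_Mapping.keys P)"
    by (rule inj_onI) (rule substitute_inj[OF t_inj keys keys])
  define E where "E = substitute t ` Poly_Mapping.keys P"
  \<comment> \<open>The coefficients of \<open>P\<close>, re-indexed by multisets of parameters.\<close>
  define c where "c p = Poly_Mapping.lookup P (the_inv_into (Poly_Mapping.keys P) (substitute t) p)" for p
  have c: "c (substitute t m) = Poly_Mapping.lookup P m" if "m \<in> Poly_Mapping.keys P" for m
    using the_inv_into_f_f[OF inj that] by (simp add: c_def)
  have eval: "eval_poly P f = (\<Sum>p\<in>E. c p *\<^sub>R spike_monomial p)"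
  proof -
    have "eval_poly P f = (\<Sum>m\<in>Poly_Mapping.keys P. c (substitute t m) *\<^sub>R spike_monomial (substitute t m))"
      unfolding eval_poly_def
    proof (intro sum.cong refl)
      fix m assume m: "m \<in> Poly_Mapping.keys P"
      have "(\<Prod>i\<in>Poly_Mapping.keys m. f i ^ Poly_Mapping.lookup m i) = spike_monomial (substitute t m)"
        unfolding spike_monomial_substitute using keys[OF m] t by (intro prod.cong) auto
      then show "Poly_Mapping.lookup P m *\<^sub>R (\<Prod>i\<in>Poly_Mapping.keys m. f i ^ Poly_Mapping.lookup m i)
          = c (substitute t m) *\<^sub>R spike_monomial (substitute t m)"
        using c[OF m] by simp
    qed
    then show ?thesis by (simp add: E_def sum.reindex[OF inj])
  qed
  have E_ne: "p \<noteq> {#}" if "p \<in> E" for p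
    using that nonzero substitute_nonempty by (auto simp: E_def)
  have mem: "eval_poly P f \<in> spike_algebra"
    unfolding eval spike_algebra_def
    using E_ne by (intro span_sum span_scale span_base imageI) auto
  moreover have "eval_poly P f \<noteq> 0"
  proof -
    obtain m where "m \<in> Poly_Mapping.keys P" using P(2) by fastforce
    then have "c (substitute t m) \<noteq> 0" "substitute t m \<in> E"
      using c by (auto simp: in_keys_iff E_def)
    then show ?thesis
      unfolding eval using E_ne by (intro spike_combination_nonzero(2)) (auto simp: E_def)
  qed
  ultimately show "eval_poly P f \<in> spike_algebra - {0}" by simp
qed

text \<open>Finitely many elements lie in the span of the monomials over a finite set \<open>U\<close> of parameters. This span
  is a subalgebra, and by linear independence it does not contain \<open>spike t\<close> for \<open>t \<notin> U\<close>.\<close>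

lemma infinitely_generated_spike_algebra: "infinitely_generated spike_algebra"
  unfolding infinitely_generated_def
proof (intro allI impI notI)
  fix S assume hull: "subalgebra hull S = spike_algebra" and "finite S"
  have "\<forall>f\<in>S. \<exists>T. finite T \<and> f \<in> span (spike_monomial ` {p. p \<noteq> {#} \<and> set_mset p \<subseteq> T})"
  proof
    fix f assume "f \<in> S"
    then have "f \<in> span (spike_monomial ` (- {{#}}))"
      using hull_inc[of f S subalgebra] by (simp add: hull spike_algebra_def)
    from span_image_obtain_combination[OF this spike_monomial_inj]
    obtain E c where E: "finite E" "E \<subseteq> - {{#}}" "f = (\<Sum>p\<in>E. c p *\<^sub>R spike_monomial p)" .
    let ?T = "\<Union>(set_mset ` E)"
    have "f \<in> span (spike_monomial ` {p. p \<noteq> {#} \<and> set_mset p \<subseteq> ?T})"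
      unfolding E(3) using E(2) by (intro span_sum span_scale span_base) auto
    then show "\<exists>T. finite T \<and> f \<in> span (spike_monomial ` {p. p \<noteq> {#} \<and> set_mset p \<subseteq> T})"
      using E(1) by (intro exI[of _ ?T]) auto
  qed
  from bchoice[OF this] obtain T where T: "\<And>f. f \<in> S \<Longrightarrow> finite (T f)"
      "\<And>f. f \<in> S \<Longrightarrow> f \<in> span (spike_monomial ` {p. p \<noteq> {#} \<and> set_mset p \<subseteq> T f})"
    by blast
  define U where "U = \<Union>(T ` S)"
  define P where "P = {p. p \<noteq> {#} \<and> set_mset p \<subseteq> U}"
  have "finite U" using \<open>finite S\<close> T(1) by (simp add: U_def)
  then obtain t :: real where "t \<notin> U" using ex_new_if_finite infinite_UNIV_char_0 by blast
  have "S \<subseteq> span (spike_monomial ` P)"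
  proof
    fix f assume "f \<in> S"
    then show "f \<in> span (spike_monomial ` P)"
      by (intro subsetD[OF span_mono T(2)]) (auto simp: P_def U_def)
  qed
  moreover have "subalgebra (span (spike_monomial ` P))"
    by (rule subalgebra_span_spike_monomials) (auto simp: P_def)
  ultimately have "spike_algebra \<subseteq> span (spike_monomial ` P)"
    unfolding hull[symmetric] by (rule hull_minimal)
  also have "\<dots> \<subseteq> span (spike_monomial ` (- {{#}}) - {spike_monomial {#t#}})"
  proof (rule span_mono, rule image_subsetI)
    fix p assume p: "p \<in> P"
    then have "p \<noteq> {#t#}" using \<open>t \<notin> U\<close> by (auto simp: P_def)
    then have "spike_monomial p \<noteq> spike_monomial {#t#}"
      using inj_onD[OF spike_monomial_inj, of p "{#t#}"] p by (auto simp: P_def)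
    then show "spike_monomial p \<in> spike_monomial ` (- {{#}}) - {spike_monomial {#t#}}"
      using p by (auto simp: P_def)
  qed
  finally have "spike_monomial {#t#} \<in> span (spike_monomial ` (- {{#}}) - {spike_monomial {#t#}})"
    by (rule subsetD) (unfold spike_algebra_def, intro span_base imageI, simp)
  moreover have "spike_monomial {#t#} \<in> spike_monomial ` (- {{#}})" by (rule imageI) simp
  ultimately show False
    using independent_spike_monomials unfolding dependent_def by blast
qed

lemma strongly_algebrable_growth_set: "strongly_algebrable cont_half (growth_set \<alpha>)"
  unfolding strongly_algebrable_def free_algebra_def
  using subalgebra_spike_algebra spike_algebra_cont_half free_generators_spikes
    infinitely_generated_spike_algebra spike_algebra_growth by blast


section \<open>A dense subspace of maximal dimension\<close>

lemma approximation_by_truncation_and_spike: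
  assumes g: "g \<in> cont_L1" and "e > 0"
  obtains h \<epsilon> where "h \<in> cont_L1" "\<forall>\<^sub>F x in at_top. h x = 0" "\<epsilon> \<noteq> 0"
    "dist_X g (h + \<epsilon> *\<^sub>R spike_monomial {#t#}) < e"
proof -
  let ?s = "spike_monomial {#t#}"
  have s: "?s \<in> cont_L1" by (rule spike_monomial_cont_L1) simp
  have "\<forall>\<^sub>F r in sequentially. dist_X g (truncate r g) < e / 2"
    using truncate_tendsto[OF g] \<open>e > 0\<close> by (intro order_tendstoD) auto
  then obtain r where r: "dist_X g (truncate r g) < e / 2"
    by (auto simp: eventually_sequentially)
  have "\<forall>\<^sub>F j in sequentially. dist_X (inverse (real (Suc j)) *\<^sub>R ?s) 0 < e / 2"
    using dist_X_scale_tendsto_0[OF s] \<open>e > 0\<close> by (intro order_tendstoD) auto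
  then obtain j where j: "dist_X (inverse (real (Suc j)) *\<^sub>R ?s) 0 < e / 2"
    by (auto simp: eventually_sequentially)
  define \<epsilon> where "\<epsilon> = inverse (real (Suc j))"
  have h: "truncate r g \<in> cont_L1" by (rule truncate_cont_L1[OF g])
  have es: "\<epsilon> *\<^sub>R ?s \<in> cont_L1" by (intro subspace_scale[OF subspace_cont_L1] s)
  have b: "truncate r g + \<epsilon> *\<^sub>R ?s \<in> cont_L1" by (intro subspace_add[OF subspace_cont_L1] h es)
  interpret Metric_space cont_L1 dist_X by (rule Metric_space_X)
  have "dist_X g (truncate r g + \<epsilon> *\<^sub>R ?s)
      \<le> dist_X g (truncate r g) + dist_X (truncate r g) (truncate r g + \<epsilon> *\<^sub>R ?s)"
    by (rule triangle[OF g h b])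
  also have "dist_X (truncate r g) (truncate r g + \<epsilon> *\<^sub>R ?s) = dist_X (\<epsilon> *\<^sub>R ?s) 0"
    using dist_X_translate[OF b h] commute by simp
  also have "dist_X g (truncate r g) + dist_X (\<epsilon> *\<^sub>R ?s) 0 < e"
    using r j by (simp add: \<epsilon>_def)
  finally have near: "dist_X g (truncate r g + \<epsilon> *\<^sub>R ?s) < e" .
  have vanishing: "\<forall>\<^sub>F x in at_top. truncate r g x = 0"
    using eventually_ge_at_top[of "real r + 1"] by eventually_elim (rule truncate_eq_0)
  have "\<epsilon> \<noteq> 0" by (simp add: \<epsilon>_def)
  from that[OF h vanishing this near] show thesis .
qed

lemma perturbed_spike_combination_growth:
  assumes "finite J" and inj: "inj_on \<tau> J"
    and h: "\<And>i. i \<in> J \<Longrightarrow> h i \<in> cont_L1" "\<And>i. i \<in> J \<Longrightarrow> \<forall>\<^sub>F x in at_top. h i x = 0"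
    and \<epsilon>: "\<And>i. i \<in> J \<Longrightarrow> \<epsilon> i \<noteq> (0::real)" and c: "\<exists>i\<in>J. c i \<noteq> 0"
  shows "(\<Sum>i\<in>J. c i *\<^sub>R (h i + \<epsilon> i *\<^sub>R spike_monomial {#\<tau> i#})) \<in> growth_set \<alpha>"
proof -
  let ?p = "\<lambda>i. {#\<tau> i#}"
  have p_inj: "inj_on ?p J" using inj by (auto simp: inj_on_def)
  define c' where "c' q = c (the_inv_into J ?p q) * \<epsilon> (the_inv_into J ?p q)" for q
  have c': "c' (?p i) = c i * \<epsilon> i" if "i \<in> J" for i
    using the_inv_into_f_f[OF p_inj that] by (simp add: c'_def)
  have "(\<Sum>i\<in>J. c i *\<^sub>R (h i + \<epsilon> i *\<^sub>R spike_monomial (?p i)))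
      = (\<Sum>i\<in>J. c' (?p i) *\<^sub>R spike_monomial (?p i)) + (\<Sum>i\<in>J. c i *\<^sub>R h i)"
    unfolding sum.distrib[symmetric] by (intro sum.cong refl) (simp add: c' scaleR_add_right add.commute)
  also have "(\<Sum>i\<in>J. c' (?p i) *\<^sub>R spike_monomial (?p i)) = (\<Sum>q\<in>?p ` J. c' q *\<^sub>R spike_monomial q)"
    by (simp add: sum.reindex[OF p_inj])
  finally have eq: "(\<Sum>i\<in>J. c i *\<^sub>R (h i + \<epsilon> i *\<^sub>R spike_monomial (?p i)))
      = (\<Sum>q\<in>?p ` J. c' q *\<^sub>R spike_monomial q) + (\<Sum>i\<in>J. c i *\<^sub>R h i)" .
  have "\<forall>\<^sub>F x in at_top. \<forall>i\<in>J. h i x = 0"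
    using h(2) \<open>finite J\<close> by (intro eventually_ball_finite) auto
  then have ev: "\<forall>\<^sub>F x in at_top. (\<Sum>i\<in>J. c i *\<^sub>R h i) x = 0"
    by eventually_elim (simp add: sum_fun_apply)
  show ?thesis
    unfolding eq
  proof (rule spike_combination_growth_if_nonzero[OF _ _ _ _ ev])
    show "\<exists>q\<in>?p ` J. c' q \<noteq> 0" using c c' \<epsilon> by fastforce
    show "(\<Sum>i\<in>J. c i *\<^sub>R h i) \<in> cont_L1"
      by (intro subspace_sum[OF subspace_cont_L1] subspace_scale[OF subspace_cont_L1] h)
  qed (use \<open>finite J\<close> in auto)
qed

text \<open>The subspace is the span of an independent family with as many members as \<open>X\<close> has elements. A
  basis of \<open>X\<close> that extends the family is squeezed between it and \<open>X\<close>, so it is of the same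
  cardinality.\<close>

lemma maximal_dense_lineable_growth_set: "maximal_dense_lineable topology_X (growth_set \<alpha>)"
proof -
  interpret Metric_space cont_L1 dist_X by (rule Metric_space_X)
  define I where "I = cont_L1 \<times> (UNIV :: nat set)"
  obtain \<tau> :: "(real \<Rightarrow> real) \<times> nat \<Rightarrow> real" where \<tau>: "inj_on \<tau> I"
    using cont_L1_times_nat_lepoll_real by (auto simp: lepoll_def I_def)
  have "\<exists>h \<epsilon>. i \<in> I \<longrightarrow> h \<in> cont_L1 \<and> (\<forall>\<^sub>F x in at_top. h x = 0) \<and> \<epsilon> \<noteq> 0
      \<and> dist_X (fst i) (h + \<epsilon> *\<^sub>R spike_monomial {#\<tau> i#}) < inverse (real (Suc (snd i)))" for i
  proof (cases "i \<in> I")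
    case True
    then have "fst i \<in> cont_L1" "0 < inverse (real (Suc (snd i)))" by (auto simp: I_def)
    from approximation_by_truncation_and_spike[OF this] show ?thesis by metis
  qed simp
  then obtain h \<epsilon> where h: "\<And>i. i \<in> I \<Longrightarrow> h i \<in> cont_L1" "\<And>i. i \<in> I \<Longrightarrow> \<forall>\<^sub>F x in at_top. h i x = 0"
    and \<epsilon>: "\<And>i. i \<in> I \<Longrightarrow> \<epsilon> i \<noteq> 0"
    and near: "\<And>i. i \<in> I \<Longrightarrow>
      dist_X (fst i) (h i + \<epsilon> i *\<^sub>R spike_monomial {#\<tau> i#}) < inverse (real (Suc (snd i)))"
    by metis
  define b where "b i = h i + \<epsilon> i *\<^sub>R spike_monomial {#\<tau> i#}" for i
  define M where "M = span (b ` I)"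
  have b_X: "b i \<in> cont_L1" if "i \<in> I" for i
    using h(1)[OF that] unfolding b_def
    by (intro subspace_add[OF subspace_cont_L1] subspace_scale[OF subspace_cont_L1] spike_monomial_cont_L1) auto
  have combination: "(\<Sum>i\<in>J. c i *\<^sub>R b i) \<in> growth_set \<alpha>"
    if "finite J" "J \<subseteq> I" "\<exists>i\<in>J. c i \<noteq> 0" for J c
    unfolding b_def
    using that \<tau> h \<epsilon> by (intro perturbed_spike_combination_growth) (auto intro: inj_on_subset)
  have b_inj: "inj_on b I" and indep: "independent (b ` I)"
    using independent_imageI[of I b] combination growth_set_nonzero by blast+
  have M_X: "M \<subseteq> cont_L1"
    unfolding M_def using b_X by (intro span_minimal subspace_cont_L1) auto
  have "M - {0} \<subseteq> growth_set \<alpha>"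
  proof
    fix f assume f: "f \<in> M - {0}"
    then have "f \<in> span (b ` I)" by (simp add: M_def)
    from span_image_obtain_combination[OF this b_inj]
    obtain J c where J: "finite J" "J \<subseteq> I" "f = (\<Sum>i\<in>J. c i *\<^sub>R b i)" .
    have "\<exists>i\<in>J. c i \<noteq> 0"
    proof (rule ccontr)
      assume "\<not> (\<exists>i\<in>J. c i \<noteq> 0)"
      then have "f = 0" by (simp add: J(3))
      with f show False by simp
    qed
    with J show "f \<in> growth_set \<alpha>" using combination by simp
  qed
  moreover have "topology_X closure_of M = cont_L1"
  proof -
    have "\<exists>y\<in>M. y \<in> mball g r" if "g \<in> cont_L1" "r > 0" for g r
    proof -
      obtain j where j: "inverse (real (Suc j)) < r" using reals_Archimedean[OF \<open>r > 0\<close>] by blast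
      have i: "(g, j) \<in> I" using that(1) by (simp add: I_def)
      have "b (g, j) \<in> M" unfolding M_def by (intro span_base imageI i)
      moreover have "b (g, j) \<in> mball g r"
        using less_trans[OF near[OF i, folded b_def]] j b_X[OF i] that(1) by simp
      ultimately show ?thesis by blast
    qed
    then show ?thesis unfolding topology_X_def metric_closure_of by blast
  qed
  moreover have "same_hamel_dim M cont_L1"
  proof -
    have "b ` I \<subseteq> cont_L1" using b_X by auto
    from maximal_independent_subset_extend[OF this indep]
    obtain C where C: "b ` I \<subseteq> C" "C \<subseteq> cont_L1" "independent C" "cont_L1 \<subseteq> span C" by metis
    have "span C = cont_L1"
      using C(4) span_minimal[OF C(2) subspace_cont_L1] by auto
    have "C \<lesssim> cont_L1" using C(2) by (rule subset_imp_lepoll)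
    also have "cont_L1 \<lesssim> I"
      unfolding lepoll_def I_def by (intro exI[of _ "\<lambda>g. (g, 0)"]) (auto simp: inj_on_def)
    also have "I \<lesssim> b ` I" unfolding lepoll_def using b_inj by blast
    finally have "b ` I \<approx> C"
      using subset_imp_lepoll[OF C(1)] by (intro lepoll_antisym)
    then show ?thesis
      unfolding same_hamel_dim_def using indep C(3) \<open>span C = cont_L1\<close> M_def by blast
  qed
  ultimately show ?thesis
    unfolding maximal_dense_lineable_def topspace_X
    using M_X subspace_span M_def by blast
qed

end

theorem theorem4p2:
  fixes \<alpha> :: "real \<Rightarrow> real"
  assumes "continuous_on {0..} \<alpha>"
    and "mono_on {0..} \<alpha>"
    and "\<And>x. 0 \<le> x \<Longrightarrow> 1 \<le> \<alpha> x"
  shows "maximal_dense_lineable topology_X (growth_set \<alpha>)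
       \<and> strongly_algebrable cont_half (growth_set \<alpha>)"
proof -
  interpret growth_weight \<alpha> using assms by unfold_locales
  show ?thesis
    using maximal_dense_lineable_growth_set strongly_algebrable_growth_set by blast
qed

end
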